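(* Let $R=\begin{pmatrix} A & M\\ N & B\end{pmatrix}$ be a Morita context ring whose trace ideals $MN\subseteq A$ and $NM\subseteq B$ are nilpotent ideals. Then $R$ is unit nil-clean if and only if both rings $A$ and $B$ are unit nil-clean; likewise, $R$ is strongly unit nil-clean if and only if both $A$ and $B$ are strongly unit nil-clean.
   Context: Rings are associative with identity, not necessarily commutative. An element of a ring is nil-clean if it is the sum of an idempotent $e$ and a nilpotent $b$, and strongly nil-clean if moreover one can choose $eb=be$. A ring $S$ is (strongly) unit nil-clean if for every $a\in S$ there is a unit $u\in S$ such that $ua$ is (strongly) nil-clean. Morita context: $A,B$ are rings, $M$ is an $(A,B)$-bimodule, $N$ is a $(B,A)$-bimodule, and $\varphi:M\otimes_B N\to A$, $\psi:N\otimes_A M\to B$ are bimodule homomorphisms such that, writing $mn:=\varphi(m\otimes n)$ and $nm:=\psi(n\otimes m)$, one has $b(mn)=(bm)n$ for all $b,n\in N$, $m\in M$, and $a(nm)=(an)m$ for all $a,m\in M$, $n\in N$. The set of matrices $\begin{pmatrix} a & m\\ n & b\end{pmatrix}$ ($a\in A$, $m\in M$, $n\in N$, $b\in B$) with the usual matrix addition and multiplication is then an associative ring, called the Morita context ring. The trace ideals are $MN:=\operatorname{Im}\varphi$ and $NM:=\operatorname{Im}\psi$, two-sided ideals of $A$ and $B$ respectively. *)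

theory Defs
  imports "HOL-Algebra.Algebra"
begin

section \<open>Nil-clean elements and unit nil-clean rings\<close>

definition idempotent_elem :: "('a, 'x) ring_scheme \<Rightarrow> 'a \<Rightarrow> bool"
  where "idempotent_elem R e \<longleftrightarrow> e \<in> carrier R \<and> e \<otimes>\<^bsub>R\<^esub> e = e"

definition nilpotent_elem :: "('a, 'x) ring_scheme \<Rightarrow> 'a \<Rightarrow> bool"
  where "nilpotent_elem R b \<longleftrightarrow> b \<in> carrier R \<and> (\<exists>n::nat. n > 0 \<and> b [^]\<^bsub>R\<^esub> n = \<zero>\<^bsub>R\<^esub>)"

definition nil_clean :: "('a, 'x) ring_scheme \<Rightarrow> 'a \<Rightarrow> bool"
  where "nil_clean R x \<longleftrightarrow>
    (\<exists>e b. idempotent_elem R e \<and> nilpotent_elem R b \<and> x = e \<oplus>\<^bsub>R\<^esub> b)"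

definition strongly_nil_clean :: "('a, 'x) ring_scheme \<Rightarrow> 'a \<Rightarrow> bool"
  where "strongly_nil_clean R x \<longleftrightarrow>
    (\<exists>e b. idempotent_elem R e \<and> nilpotent_elem R b \<and> x = e \<oplus>\<^bsub>R\<^esub> b
      \<and> e \<otimes>\<^bsub>R\<^esub> b = b \<otimes>\<^bsub>R\<^esub> e)"

definition unit_nil_clean :: "('a, 'x) ring_scheme \<Rightarrow> bool"
  where "unit_nil_clean R \<longleftrightarrow> (\<forall>a \<in> carrier R. \<exists>u \<in> Units R. nil_clean R (u \<otimes>\<^bsub>R\<^esub> a))"

definition strongly_unit_nil_clean :: "('a, 'x) ring_scheme \<Rightarrow> bool"
  where "strongly_unit_nil_clean R \<longleftrightarrow>
    (\<forall>a \<in> carrier R. \<exists>u \<in> Units R. strongly_nil_clean R (u \<otimes>\<^bsub>R\<^esub> a))"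

text \<open>Powers of an ideal are taken in \<^const>\<open>ideals_set\<close>, whose multiplication is the product of
  ideals \<^const>\<open>ideal_prod\<close>.\<close>

definition nilpotent_ideal :: "('a, 'x) ring_scheme \<Rightarrow> 'a set \<Rightarrow> bool"
  where "nilpotent_ideal R I \<longleftrightarrow>
    ideal I R \<and> (\<exists>n::nat. n > 0 \<and> I [^]\<^bsub>ideals_set R\<^esub> n = {\<zero>\<^bsub>R\<^esub>})"


section \<open>Bimodules over noncommutative rings\<close>

text \<open>As for the record \<^type>\<open>module\<close>, the multiplicative fields inherited from \<^type>\<open>ring\<close>
  carry no meaning.\<close>

record ('a, 'b, 'm) bimodule = "'m ring" +
  lact :: "'a \<Rightarrow> 'm \<Rightarrow> 'm" (infixr \<open>\<triangleright>\<index>\<close> 72)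
  ract :: "'m \<Rightarrow> 'b \<Rightarrow> 'm" (infixl \<open>\<triangleleft>\<index>\<close> 72)

locale bimodule = A?: ring A + B?: ring B + V?: abelian_group V
  for A :: "('a, 'x) ring_scheme" (structure) and B :: "('b, 'y) ring_scheme" (structure)
    and V :: "('a, 'b, 'm, 'v) bimodule_scheme" (structure) +
  assumes lact_closed:
      "\<lbrakk>a \<in> carrier A; x \<in> carrier V\<rbrakk> \<Longrightarrow> a \<triangleright>\<^bsub>V\<^esub> x \<in> carrier V"
    and lact_l_distr:
      "\<lbrakk>a \<in> carrier A; a' \<in> carrier A; x \<in> carrier V\<rbrakk> \<Longrightarrow>
        (a \<oplus>\<^bsub>A\<^esub> a') \<triangleright>\<^bsub>V\<^esub> x = (a \<triangleright>\<^bsub>V\<^esub> x) \<oplus>\<^bsub>V\<^esub> (a' \<triangleright>\<^bsub>V\<^esub> x)"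
    and lact_r_distr:
      "\<lbrakk>a \<in> carrier A; x \<in> carrier V; y \<in> carrier V\<rbrakk> \<Longrightarrow>
        a \<triangleright>\<^bsub>V\<^esub> (x \<oplus>\<^bsub>V\<^esub> y) = (a \<triangleright>\<^bsub>V\<^esub> x) \<oplus>\<^bsub>V\<^esub> (a \<triangleright>\<^bsub>V\<^esub> y)"
    and lact_assoc:
      "\<lbrakk>a \<in> carrier A; a' \<in> carrier A; x \<in> carrier V\<rbrakk> \<Longrightarrow>
        (a \<otimes>\<^bsub>A\<^esub> a') \<triangleright>\<^bsub>V\<^esub> x = a \<triangleright>\<^bsub>V\<^esub> (a' \<triangleright>\<^bsub>V\<^esub> x)"
    and lact_one:
      "x \<in> carrier V \<Longrightarrow> \<one>\<^bsub>A\<^esub> \<triangleright>\<^bsub>V\<^esub> x = x"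
    and ract_closed:
      "\<lbrakk>x \<in> carrier V; b \<in> carrier B\<rbrakk> \<Longrightarrow> x \<triangleleft>\<^bsub>V\<^esub> b \<in> carrier V"
    and ract_r_distr:
      "\<lbrakk>x \<in> carrier V; b \<in> carrier B; b' \<in> carrier B\<rbrakk> \<Longrightarrow>
        x \<triangleleft>\<^bsub>V\<^esub> (b \<oplus>\<^bsub>B\<^esub> b') = (x \<triangleleft>\<^bsub>V\<^esub> b) \<oplus>\<^bsub>V\<^esub> (x \<triangleleft>\<^bsub>V\<^esub> b')"
    and ract_l_distr:
      "\<lbrakk>x \<in> carrier V; y \<in> carrier V; b \<in> carrier B\<rbrakk> \<Longrightarrow>
        (x \<oplus>\<^bsub>V\<^esub> y) \<triangleleft>\<^bsub>V\<^esub> b = (x \<triangleleft>\<^bsub>V\<^esub> b) \<oplus>\<^bsub>V\<^esub> (y \<triangleleft>\<^bsub>V\<^esub> b)"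
    and ract_assoc:
      "\<lbrakk>x \<in> carrier V; b \<in> carrier B; b' \<in> carrier B\<rbrakk> \<Longrightarrow>
        x \<triangleleft>\<^bsub>V\<^esub> (b \<otimes>\<^bsub>B\<^esub> b') = (x \<triangleleft>\<^bsub>V\<^esub> b) \<triangleleft>\<^bsub>V\<^esub> b'"
    and ract_one:
      "x \<in> carrier V \<Longrightarrow> x \<triangleleft>\<^bsub>V\<^esub> \<one>\<^bsub>B\<^esub> = x"
    and lact_ract:
      "\<lbrakk>a \<in> carrier A; x \<in> carrier V; b \<in> carrier B\<rbrakk> \<Longrightarrow>
        (a \<triangleright>\<^bsub>V\<^esub> x) \<triangleleft>\<^bsub>V\<^esub> b = a \<triangleright>\<^bsub>V\<^esub> (x \<triangleleft>\<^bsub>V\<^esub> b)"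

definition bimodule_hom ::
    "('a, 'x) ring_scheme \<Rightarrow> ('b, 'y) ring_scheme \<Rightarrow> ('a, 'b, 'm, 'v) bimodule_scheme \<Rightarrow>
     ('a, 'b, 'k, 'w) bimodule_scheme \<Rightarrow> ('m \<Rightarrow> 'k) set"
  where "bimodule_hom A B V W =
    {f \<in> hom (add_monoid V) (add_monoid W).
       (\<forall>a \<in> carrier A. \<forall>x \<in> carrier V. f (a \<triangleright>\<^bsub>V\<^esub> x) = a \<triangleright>\<^bsub>W\<^esub> f x) \<and>
       (\<forall>x \<in> carrier V. \<forall>b \<in> carrier B. f (x \<triangleleft>\<^bsub>V\<^esub> b) = f x \<triangleleft>\<^bsub>W\<^esub> b)}"

text \<open>A ring as a bimodule over itself.\<close>

definition regular_bimodule :: "('a, 'x) ring_scheme \<Rightarrow> ('a, 'a, 'a) bimodule"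
  where "regular_bimodule R =
    \<lparr>carrier = carrier R, monoid.mult = monoid.mult R, one = \<one>\<^bsub>R\<^esub>,
     ring.zero = \<zero>\<^bsub>R\<^esub>, add = ring.add R,
     lact = monoid.mult R, ract = monoid.mult R\<rparr>"


section \<open>Tensor product of bimodules\<close>

text \<open>\<open>M \<otimes>\<^sub>B N\<close> is the free abelian group on \<open>M \<times> N\<close> modulo the subgroup generated by the
  relations of biadditivity and \<open>B\<close>-balancedness.\<close>

abbreviation tensor_free ::
    "('a, 'b, 'm, 'v) bimodule_scheme \<Rightarrow> ('b, 'c, 'n, 'w) bimodule_scheme \<Rightarrow>
     ('m \<times> 'n \<Rightarrow>\<^sub>0 int) monoid"
  where "tensor_free M N \<equiv> free_Abelian_group (carrier M \<times> carrier N)"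

definition tensor_relations ::
    "('b, 'y) ring_scheme \<Rightarrow> ('a, 'b, 'm, 'v) bimodule_scheme \<Rightarrow>
     ('b, 'c, 'n, 'w) bimodule_scheme \<Rightarrow> ('m \<times> 'n \<Rightarrow>\<^sub>0 int) set"
  where "tensor_relations B M N =
    {frag_of (m \<oplus>\<^bsub>M\<^esub> m', n) - frag_of (m, n) - frag_of (m', n) | m m' n.
       m \<in> carrier M \<and> m' \<in> carrier M \<and> n \<in> carrier N} \<union>
    {frag_of (m, n \<oplus>\<^bsub>N\<^esub> n') - frag_of (m, n) - frag_of (m, n') | m n n'.
       m \<in> carrier M \<and> n \<in> carrier N \<and> n' \<in> carrier N} \<union>
    {frag_of (m \<triangleleft>\<^bsub>M\<^esub> b, n) - frag_of (m, b \<triangleright>\<^bsub>N\<^esub> n) | m b n.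
       m \<in> carrier M \<and> b \<in> carrier B \<and> n \<in> carrier N}"

definition tensor_kernel ::
    "('b, 'y) ring_scheme \<Rightarrow> ('a, 'b, 'm, 'v) bimodule_scheme \<Rightarrow>
     ('b, 'c, 'n, 'w) bimodule_scheme \<Rightarrow> ('m \<times> 'n \<Rightarrow>\<^sub>0 int) set"
  where "tensor_kernel B M N = generate (tensor_free M N) (tensor_relations B M N)"

definition pure_tensor ::
    "('b, 'y) ring_scheme \<Rightarrow> ('a, 'b, 'm, 'v) bimodule_scheme \<Rightarrow>
     ('b, 'c, 'n, 'w) bimodule_scheme \<Rightarrow> 'm \<Rightarrow> 'n \<Rightarrow> ('m \<times> 'n \<Rightarrow>\<^sub>0 int) set"
  where "pure_tensor B M N m n = tensor_kernel B M N #>\<^bsub>tensor_free M N\<^esub> frag_of (m, n)"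

text \<open>The outer actions are induced by \<open>a (m \<otimes> n) = (a m) \<otimes> n\<close> and \<open>(m \<otimes> n) c = m \<otimes> (n c)\<close>. The
  additive extension of such a map to the free abelian group sends a coset \<open>T\<close> into a single coset,
  and adding the kernel to the image of \<open>T\<close> completes it to that coset.\<close>

definition tensor_product ::
    "('b, 'y) ring_scheme \<Rightarrow> ('a, 'b, 'm, 'v) bimodule_scheme \<Rightarrow>
     ('b, 'c, 'n, 'w) bimodule_scheme \<Rightarrow> ('a, 'c, ('m \<times> 'n \<Rightarrow>\<^sub>0 int) set) bimodule"
  where "tensor_product B M N =
    \<lparr>carrier = carrier (tensor_free M N Mod tensor_kernel B M N),
     monoid.mult = undefined,
     one = undefined,
     ring.zero = \<one>\<^bsub>tensor_free M N Mod tensor_kernel B M N\<^esub>,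
     add = (\<otimes>\<^bsub>tensor_free M N Mod tensor_kernel B M N\<^esub>),
     lact = (\<lambda>a T. tensor_kernel B M N <#>\<^bsub>tensor_free M N\<^esub>
               frag_extend (\<lambda>(m, n). frag_of (a \<triangleright>\<^bsub>M\<^esub> m, n)) ` T),
     ract = (\<lambda>T c. tensor_kernel B M N <#>\<^bsub>tensor_free M N\<^esub>
               frag_extend (\<lambda>(m, n). frag_of (m, n \<triangleleft>\<^bsub>N\<^esub> c)) ` T)\<rparr>"


section \<open>Morita contexts\<close>

locale morita_context =
  A?: ring A + B?: ring B + M?: bimodule A B M + N?: bimodule B A N
  for A :: "('a, 'x) ring_scheme" (structure) and B :: "('b, 'y) ring_scheme" (structure)
    and M :: "('a, 'b, 'm, 'v) bimodule_scheme" (structure)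
    and N :: "('b, 'a, 'n, 'w) bimodule_scheme" (structure) +
  fixes \<phi> :: "('m \<times> 'n \<Rightarrow>\<^sub>0 int) set \<Rightarrow> 'a"
    and \<psi> :: "('n \<times> 'm \<Rightarrow>\<^sub>0 int) set \<Rightarrow> 'b"
  assumes phi_hom: "\<phi> \<in> bimodule_hom A A (tensor_product B M N) (regular_bimodule A)"
    and psi_hom: "\<psi> \<in> bimodule_hom B B (tensor_product A N M) (regular_bimodule B)"
    and compat_N:
      "\<lbrakk>b \<in> carrier N; m \<in> carrier M; n \<in> carrier N\<rbrakk> \<Longrightarrow>
        b \<triangleleft>\<^bsub>N\<^esub> \<phi> (pure_tensor B M N m n) = \<psi> (pure_tensor A N M b m) \<triangleright>\<^bsub>N\<^esub> n"
    and compat_M: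
      "\<lbrakk>a \<in> carrier M; n \<in> carrier N; m \<in> carrier M\<rbrakk> \<Longrightarrow>
        a \<triangleleft>\<^bsub>M\<^esub> \<psi> (pure_tensor A N M n m) = \<phi> (pure_tensor B M N a n) \<triangleright>\<^bsub>M\<^esub> m"

text \<open>The tuple \<open>(a, m, n, b)\<close> stands for the matrix with rows \<open>(a, m)\<close> and \<open>(n, b)\<close>.\<close>

definition morita_ring ::
    "('a, 'x) ring_scheme \<Rightarrow> ('b, 'y) ring_scheme \<Rightarrow> ('a, 'b, 'm, 'v) bimodule_scheme \<Rightarrow>
     ('b, 'a, 'n, 'w) bimodule_scheme \<Rightarrow> (('m \<times> 'n \<Rightarrow>\<^sub>0 int) set \<Rightarrow> 'a) \<Rightarrow>
     (('n \<times> 'm \<Rightarrow>\<^sub>0 int) set \<Rightarrow> 'b) \<Rightarrow> ('a \<times> 'm \<times> 'n \<times> 'b) ring"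
  where "morita_ring A B M N \<phi> \<psi> =
    \<lparr>carrier = carrier A \<times> carrier M \<times> carrier N \<times> carrier B,
     monoid.mult = (\<lambda>(a, m, n, b) (a', m', n', b').
       (a \<otimes>\<^bsub>A\<^esub> a' \<oplus>\<^bsub>A\<^esub> \<phi> (pure_tensor B M N m n'),
        (a \<triangleright>\<^bsub>M\<^esub> m') \<oplus>\<^bsub>M\<^esub> (m \<triangleleft>\<^bsub>M\<^esub> b'),
        (n \<triangleleft>\<^bsub>N\<^esub> a') \<oplus>\<^bsub>N\<^esub> (b \<triangleright>\<^bsub>N\<^esub> n'),
        \<psi> (pure_tensor A N M n m') \<oplus>\<^bsub>B\<^esub> b \<otimes>\<^bsub>B\<^esub> b')),
     one = (\<one>\<^bsub>A\<^esub>, \<zero>\<^bsub>M\<^esub>, \<zero>\<^bsub>N\<^esub>, \<one>\<^bsub>B\<^esub>),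
     ring.zero = (\<zero>\<^bsub>A\<^esub>, \<zero>\<^bsub>M\<^esub>, \<zero>\<^bsub>N\<^esub>, \<zero>\<^bsub>B\<^esub>),
     add = (\<lambda>(a, m, n, b) (a', m', n', b').
       (a \<oplus>\<^bsub>A\<^esub> a', m \<oplus>\<^bsub>M\<^esub> m', n \<oplus>\<^bsub>N\<^esub> n', b \<oplus>\<^bsub>B\<^esub> b'))\<rparr>"

end

theory Submission
  imports Defs
begin

text \<open>If a surjective ring homomorphism has a nil kernel, then units, idempotents and nilpotent elements
  all lift along it, and an element is strongly nil-clean iff \<open>x - x\<^sup>2\<close> is nilpotent; so both
  properties hold in the source iff they hold in the target. Apply this to \<open>A \<rightarrow> A/MN\<close>,
  \<open>B \<rightarrow> B/NM\<close> and to the diagonal map from the Morita context ring to \<open>A/MN \<times> B/NM\<close>. Its kernel,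
  with rows \<open>(MN, M)\<close> and \<open>(N, NM)\<close>, is nil: testing entries by pairing them into \<open>A\<close>, every two
  further factors from the kernel push the entries one power of \<open>MN\<close> deeper.\<close>

section \<open>Nilpotent and idempotent elements\<close>

text \<open>Lifting \<open>e\<close> and \<open>b\<close> separately would lose the relation
  \<open>eb = be\<close>; nilpotency of \<open>x - x^2\<close> mentions no decomposition and so
  transfers directly. That criterion in turn asks for an idempotent commuting with \<open>x\<close>,
  which is why idempotents are lifted inside a commutative subring containing \<open>x\<close>.

  The obstacle in the nilness of the kernel is that its elements have entries in \<open>M\<close>
  and \<open>N\<close>, where no ideal powers measure depth, and that \<open>mN = 0\<close> does not
  force \<open>m = 0\<close>. Hence \<open>m\<close> is measured only through the products
  \<open>mn\<close>, and the second row through its left multiples by elements of \<open>M\<close>.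
  Once the power of \<open>MN\<close> is zero, only the entry in \<open>A\<close> is sure to be
  gone. But then \<open>mN = 0\<close> and \<open>Mn = 0\<close> kill the cross terms, one more
  squaring leaves a matrix concentrated in \<open>B\<close>, and the nilpotency of \<open>NM\<close>
  disposes of it.

  Since \<phi> and \<psi> are given on cosets of a free abelian group, the biadditive products
  \<open>mn\<close> and \<open>nm\<close>, and the fact that they generate the trace ideals
  additively, have to be extracted from them.\<close>

lemma (in monoid) Units_if_mult_Units:
  assumes "a \<in> carrier G" "b \<in> carrier G" "a \<otimes> b \<in> Units G" "b \<otimes> a \<in> Units G"
  shows "a \<in> Units G"
proof -
  \<comment> \<open>Each of the two products yields an inverse of \<open>a\<close> on one side only;
    a left and a right inverse of the same element coincide.\<close>
  let ?r = "b \<otimes> inv (a \<otimes> b)" and ?l = "inv (b \<otimes> a) \<otimes> b"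
  have r: "a \<otimes> ?r = \<one>"
    using assms by (simp add: m_assoc[symmetric])
  have l: "?l \<otimes> a = \<one>"
    using assms by (simp add: m_assoc)
  have "?l = ?l \<otimes> (a \<otimes> ?r)"
    using assms r by simp
  also have "\<dots> = ?l \<otimes> a \<otimes> ?r"
    using assms by (simp only: m_assoc[symmetric] m_closed Units_inv_closed)
  also have "\<dots> = ?r"
    using assms l by simp
  finally have "?r \<otimes> a = \<one>"
    using l by simp
  then have "\<exists>c \<in> carrier G. c \<otimes> a = \<one> \<and> a \<otimes> c = \<one>"
    using r assms by (intro bexI[of _ ?r]) auto
  then show ?thesis
    using assms(1) unfolding Units_def by blast
qed

lemma (in ring_hom_ring) hom_nat_pow:
  "x \<in> carrier R \<Longrightarrow> h (x [^] (n::nat)) = h x [^]\<^bsub>S\<^esub> n"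
  by (induction n) auto

text \<open>Passing to \<open>Suc n\<close> supplies the positive exponent that
  \<open>nilpotent_elem\<close> asks for, so callers may also use \<open>n = 0\<close>.\<close>

lemma (in ring) nilpotent_elemI:
  assumes "x \<in> carrier R" "x [^] (n::nat) = \<zero>"
  shows "nilpotent_elem R x"
  using assms nat_pow_Suc[of x n] unfolding nilpotent_elem_def
  by (metis l_null zero_less_Suc)

lemma (in ring) nat_pow_zero_ge:
  assumes "x \<in> carrier R" "x [^] (n::nat) = \<zero>" "n \<le> m"
  shows "x [^] m = \<zero>"
  using assms nat_pow_mult[of x n "m - n"] by simp

lemma (in ring) nilpotent_elem_pow:
  assumes "x \<in> carrier R" "nilpotent_elem R (x [^] (k::nat))"
  shows "nilpotent_elem R x"
  using assms nat_pow_pow nilpotent_elemI unfolding nilpotent_elem_def by metis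

lemma (in ring) nilpotent_elem_mult:
  assumes "nilpotent_elem R x" "y \<in> carrier R" "x \<otimes> y = y \<otimes> x"
  shows "nilpotent_elem R (x \<otimes> y)"
proof -
  from assms(1) obtain n :: nat where x: "x \<in> carrier R" and n: "x [^] n = \<zero>"
    by (auto simp: nilpotent_elem_def)
  have "(x \<otimes> y) [^] n = \<zero>"
    using pow_mult_distrib[OF assms(3) x assms(2), of n] n assms(2) by simp
  with x assms(2) show ?thesis
    by (intro nilpotent_elemI) auto
qed

text \<open>In place of the geometric series, \<open>(1 - x)(1 + x) = 1 - x^2\<close> reduces the
  claim to \<open>x^2\<close>, whose nilpotency exponent is smaller as soon as that of
  \<open>x\<close> exceeds 1.\<close>

lemma (in ring) one_minus_nilpotent_Units:
  assumes "x \<in> carrier R" "x [^] (n::nat) = \<zero>"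
  shows "\<one> \<ominus> x \<in> Units R"
  using assms
proof (induction n arbitrary: x)
  case 0
  then have triv: "carrier R = {\<zero>}"
    using one_zeroD by simp
  have "\<one> \<ominus> x \<in> carrier R" "\<one> \<in> carrier R"
    using 0(1) by simp_all
  then have "\<one> \<ominus> x = \<one>"
    unfolding triv by (metis singletonD)
  then show ?case
    using Units_one_closed by metis
next
  case (Suc n)
  have *: "\<one> \<ominus> x \<in> carrier R" "\<one> \<oplus> x \<in> carrier R" using Suc.prems by auto
  have "\<one> \<ominus> x \<otimes> x \<in> Units R"
  proof (cases n)
    case 0
    with Suc.prems have "x = \<zero>" by simp
    then show ?thesis by (simp add: a_minus_def)
  next
    case (Suc k)
    have "(x \<otimes> x) [^] n = x [^] (n + n)"
      using \<open>x \<in> carrier R\<close> by (simp add: pow_mult_distrib nat_pow_mult)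
    also have "\<dots> = \<zero>"
      using Suc nat_pow_zero_ge[OF Suc.prems, of "n + n"] by simp
    finally show ?thesis
      using Suc.IH[of "x \<otimes> x"] Suc.prems by auto
  qed
  moreover have "(\<one> \<ominus> x) \<otimes> (\<one> \<oplus> x) = \<one> \<ominus> x \<otimes> x" "(\<one> \<oplus> x) \<otimes> (\<one> \<ominus> x) = \<one> \<ominus> x \<otimes> x"
    using \<open>x \<in> carrier R\<close> by (simp_all add: a_minus_def l_distr r_distr l_minus r_minus minus_add a_assoc
      a_lcomm[of x \<one>] r_neg1 r_neg2)
  ultimately show ?case
    using Units_if_mult_Units[OF *] by simp
qed

text \<open>Newton iteration for \<open>x\<^sup>2 - x\<close>: replacing \<open>x\<close> by \<open>3 x\<^sup>2 - 2 x\<^sup>3\<close> squares the defect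
  \<open>x - x\<^sup>2\<close> up to a factor.\<close>

lemma (in cring) lift_idempotent_cring:
  assumes "x \<in> carrier R" "(x \<ominus> x \<otimes> x) [^] (n::nat) = \<zero>"
  shows "\<exists>z \<in> carrier R. (x \<oplus> (x \<ominus> x \<otimes> x) \<otimes> z) \<otimes> (x \<oplus> (x \<ominus> x \<otimes> x) \<otimes> z)
    = x \<oplus> (x \<ominus> x \<otimes> x) \<otimes> z"
  using assms
proof (induction n arbitrary: x)
  case 0
  then have triv: "carrier R = {\<zero>}"
    using one_zeroD by simp
  let ?e = "x \<oplus> (x \<ominus> x \<otimes> x) \<otimes> \<zero>"
  have "?e \<in> carrier R" "?e \<otimes> ?e \<in> carrier R"
    using 0(1) by simp_all
  then have "?e \<otimes> ?e = ?e"
    unfolding triv by (metis singletonD)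
  then show ?case
    by blast
next
  case (Suc n)
  define t where "t = x \<ominus> x \<otimes> x"
  \<comment> \<open>Here \<open>w = 2x - 1\<close>, so that
    \<open>y = x + t w = 3x^2 - 2x^3\<close>. From \<open>w^2 = 1 - 4t\<close> the new defect is
    \<open>t - (t + t^2)(1 - 4t) = t^2 (3 + 4t)\<close>, and \<open>s\<close> is its last
    factor.\<close>
  define w where "w = x \<oplus> x \<ominus> \<one>"
  define y where "y = x \<oplus> t \<otimes> w"
  define s where "s = \<one> \<oplus> \<one> \<oplus> \<one> \<oplus> t \<oplus> t \<oplus> t \<oplus> t"
  have x: "x \<in> carrier R" by fact
  have t: "t \<in> carrier R" using x by (simp add: t_def)
  have w: "w \<in> carrier R" using x by (simp add: w_def)
  have y: "y \<in> carrier R" using x t w by (simp add: y_def)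
  have s: "s \<in> carrier R" using t by (simp add: s_def)
  have y_defect: "y \<ominus> y \<otimes> y = t \<otimes> t \<otimes> s"
  proof -
    have "y \<ominus> y \<otimes> y = (x \<ominus> x \<otimes> x) \<oplus> t \<otimes> w \<otimes> (\<one> \<ominus> (x \<oplus> x)) \<ominus> t \<otimes> t \<otimes> (w \<otimes> w)"
      unfolding y_def using x t w by algebra
    also have "\<one> \<ominus> (x \<oplus> x) = \<ominus> w"
      unfolding w_def using x by algebra
    also have "(x \<ominus> x \<otimes> x) \<oplus> t \<otimes> w \<otimes> (\<ominus> w) \<ominus> t \<otimes> t \<otimes> (w \<otimes> w)
      = t \<ominus> t \<otimes> (w \<otimes> w) \<ominus> t \<otimes> t \<otimes> (w \<otimes> w)"
      unfolding t_def[symmetric] using t w by algebra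
    also have "w \<otimes> w = \<one> \<ominus> (t \<oplus> t \<oplus> t \<oplus> t)"
      unfolding w_def t_def using x by algebra
    also have "t \<ominus> t \<otimes> (\<one> \<ominus> (t \<oplus> t \<oplus> t \<oplus> t)) \<ominus> t \<otimes> t \<otimes> (\<one> \<ominus> (t \<oplus> t \<oplus> t \<oplus> t))
      = t \<otimes> t \<otimes> s"
      unfolding s_def using t by algebra
    finally show ?thesis .
  qed
  show ?case
  proof (cases n)
    case 0
    then have "t = \<zero>" using Suc.prems t by (simp add: t_def)
    then have "x \<otimes> x = x" using x unfolding t_def by (metis m_closed r_right_minus_eq)
    then show ?thesis using x \<open>t = \<zero>\<close> unfolding t_def[symmetric] by auto
  next
    case (Suc k)
    have "(y \<ominus> y \<otimes> y) [^] n = t [^] (n + n) \<otimes> s [^] n"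
      unfolding y_defect using t s by (simp add: nat_pow_distrib nat_pow_mult)
    also have "\<dots> = \<zero>"
      using Suc nat_pow_zero_ge[OF t Suc.prems(2)[folded t_def], of "n + n"] s by simp
    finally obtain z where z: "z \<in> carrier R"
      and e: "(y \<oplus> t \<otimes> t \<otimes> s \<otimes> z) \<otimes> (y \<oplus> t \<otimes> t \<otimes> s \<otimes> z) = y \<oplus> t \<otimes> t \<otimes> s \<otimes> z"
      using Suc.IH[OF y] unfolding y_defect by blast
    \<comment> \<open>The correction made by the recursive call is a multiple of \<open>t^2\<close>,
      hence the total correction of \<open>x\<close> is still a multiple of \<open>t\<close>. This
      form makes the idempotent agree with \<open>x\<close> modulo any ideal containing the
      defect.\<close>
    have "y \<oplus> t \<otimes> t \<otimes> s \<otimes> z = x \<oplus> t \<otimes> (w \<oplus> t \<otimes> s \<otimes> z)"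
      unfolding y_def using x t w s z by algebra
    with e have "(x \<oplus> t \<otimes> (w \<oplus> t \<otimes> s \<otimes> z)) \<otimes> (x \<oplus> t \<otimes> (w \<oplus> t \<otimes> s \<otimes> z))
      = x \<oplus> t \<otimes> (w \<oplus> t \<otimes> s \<otimes> z)"
      by simp
    moreover have "w \<oplus> t \<otimes> s \<otimes> z \<in> carrier R"
      using t w s z by simp
    ultimately show ?thesis
      unfolding t_def[symmetric] by blast
  qed
qed

section \<open>Homomorphisms with nil kernel\<close>

text \<open>Serves as a commutative ring around \<open>x\<close> in which the Newton iteration can
  run, although the ambient ring is noncommutative.\<close>

definition bicommutant :: "('a, 'x) ring_scheme \<Rightarrow> 'a \<Rightarrow> 'a set"
  where "bicommutant R x = {c \<in> carrier R. \<forall>y \<in> carrier R.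
    x \<otimes>\<^bsub>R\<^esub> y = y \<otimes>\<^bsub>R\<^esub> x \<longrightarrow> c \<otimes>\<^bsub>R\<^esub> y = y \<otimes>\<^bsub>R\<^esub> c}"

lemma (in ring) bicommutantI:
  assumes "c \<in> carrier R" "\<And>y. y \<in> carrier R \<Longrightarrow> x \<otimes> y = y \<otimes> x \<Longrightarrow> c \<otimes> y = y \<otimes> c"
  shows "c \<in> bicommutant R x"
  using assms by (simp add: bicommutant_def)

lemma (in ring) bicommutantD:
  assumes "c \<in> bicommutant R x"
  shows "c \<in> carrier R" "y \<in> carrier R \<Longrightarrow> x \<otimes> y = y \<otimes> x \<Longrightarrow> c \<otimes> y = y \<otimes> c"
  using assms by (simp_all add: bicommutant_def)

lemma (in ring) bicommutant_subcring:
  assumes x: "x \<in> carrier R"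
  shows "subcring (bicommutant R x) R"
proof (rule subcringI)
  show "subring (bicommutant R x) R"
  proof (rule subringI)
    show "bicommutant R x \<subseteq> carrier R"
      by (auto simp: bicommutant_def)
    show "\<one> \<in> bicommutant R x"
      by (simp add: bicommutant_def)
    show "\<ominus> c \<in> bicommutant R x" if "c \<in> bicommutant R x" for c
      using that by (auto simp: bicommutant_def l_minus r_minus)
    fix c d assume c: "c \<in> bicommutant R x" and d: "d \<in> bicommutant R x"
    show "c \<oplus> d \<in> bicommutant R x"
      using c d by (auto simp: bicommutant_def l_distr r_distr)
    show "c \<otimes> d \<in> bicommutant R x"
    proof (rule bicommutantI)
      fix y assume y: "y \<in> carrier R" and "x \<otimes> y = y \<otimes> x"
      then have "c \<otimes> y = y \<otimes> c" "d \<otimes> y = y \<otimes> d"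
        using c d bicommutantD by blast+
      then show "c \<otimes> d \<otimes> y = y \<otimes> (c \<otimes> d)"
        using c[THEN bicommutantD(1)] d[THEN bicommutantD(1)] y by (metis m_assoc)
    qed (use c d in \<open>auto dest: bicommutantD(1)\<close>)
  qed
next
  fix c d assume c: "c \<in> bicommutant R x" and d: "d \<in> bicommutant R x"
  \<comment> \<open>Since \<open>x\<close> commutes with itself, \<open>c\<close> commutes with
    \<open>x\<close>; so \<open>c\<close> is one of the elements with which \<open>d\<close> has to
    commute.\<close>
  have "c \<otimes> x = x \<otimes> c"
    using bicommutantD(2)[OF c x] by simp
  then have "d \<otimes> c = c \<otimes> d"
    using bicommutantD(2)[OF d] c[THEN bicommutantD(1)] by simp
  then show "c \<otimes> d = d \<otimes> c" by simp
qed

lemma (in ring) bicommutant_self: "x \<in> carrier R \<Longrightarrow> x \<in> bicommutant R x"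
  by (simp add: bicommutant_def)

text \<open>The commutative case applies inside the bicommutant of \<open>x\<close>. Both
  commutation relations come for free, since \<open>e\<close>, \<open>z\<close>, \<open>x\<close>
  and the defect all lie in that commutative ring.\<close>

lemma (in ring) lift_idempotent:
  assumes x: "x \<in> carrier R" and nil: "nilpotent_elem R (x \<ominus> x \<otimes> x)"
  obtains e z where "idempotent_elem R e" "z \<in> carrier R" "e = x \<oplus> (x \<ominus> x \<otimes> x) \<otimes> z"
    "e \<otimes> x = x \<otimes> e" "(x \<ominus> x \<otimes> x) \<otimes> z = z \<otimes> (x \<ominus> x \<otimes> x)"
proof -
  let ?C = "bicommutant R x" and ?t = "x \<ominus> x \<otimes> x"
  let ?S = "R\<lparr>carrier := ?C\<rparr>"
  have sub: "subcring ?C R" "subring ?C R"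
    using bicommutant_subcring[OF x] by (auto dest: subcring.axioms)
  interpret S: cring ?S
    using subcring_iff[OF subringE(1)[OF sub(2)]] sub(1) by simp
  have xC: "x \<in> ?C" using x by (rule bicommutant_self)
  \<comment> \<open>Additive inverses are defined by a description over the carrier, so the
    subtraction of the restricted ring has to be identified with that of \<open>R\<close>.\<close>
  have minus: "c \<ominus>\<^bsub>?S\<^esub> d = c \<ominus> d" if "c \<in> ?C" "d \<in> ?C" for c d
    using S.minus_equality[of "\<ominus> d" d] subringE(5)[OF sub(2)] that
    by (simp add: a_minus_def l_neg bicommutantD(1))
  have pow: "c [^]\<^bsub>?S\<^esub> (n::nat) = c [^] n" for c n
    by (induction n) (simp_all add: nat_pow_def)
  obtain n :: nat where n: "?t [^] n = \<zero>"
    using nil by (auto simp: nilpotent_elem_def)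
  have xx: "x \<otimes> x \<in> ?C" using S.m_closed[of x x] xC by simp
  have tC: "?t \<in> ?C"
    using S.minus_closed[of x "x \<otimes> x"] xC xx minus[OF xC xx] by simp
  obtain z where z: "z \<in> ?C" and idem: "(x \<oplus> ?t \<otimes> z) \<otimes> (x \<oplus> ?t \<otimes> z) = x \<oplus> ?t \<otimes> z"
    using S.lift_idempotent_cring[of x n] xC n by (auto simp: minus[OF xC xx] pow)
  have eC: "x \<oplus> ?t \<otimes> z \<in> ?C"
    using S.add.m_closed[of x "?t \<otimes> z"] S.m_closed[of ?t z] tC z xC by simp
  show ?thesis
  proof (rule that)
    show "idempotent_elem R (x \<oplus> ?t \<otimes> z)"
      using idem bicommutantD(1)[OF eC] by (simp add: idempotent_elem_def)
    show "(x \<oplus> ?t \<otimes> z) \<otimes> x = x \<otimes> (x \<oplus> ?t \<otimes> z)"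
      using S.m_comm[of "x \<oplus> ?t \<otimes> z" x] eC xC by simp
    show "?t \<otimes> z = z \<otimes> ?t"
      using S.m_comm[of ?t z] tC z by simp
  qed (use z bicommutantD(1) in auto)
qed

text \<open>If \<open>e\<close> and \<open>b\<close> commute, then
  \<open>x - x^2 = b (1 - 2e - b)\<close> is a multiple of \<open>b\<close> by an element commuting
  with \<open>b\<close>. Conversely, the lifted idempotent commutes with \<open>x\<close> and
  differs from it by \<open>t z\<close>, where \<open>t\<close> is nilpotent and commutes with
  \<open>z\<close>.\<close>

lemma (in ring) strongly_nil_clean_iff:
  assumes x: "x \<in> carrier R"
  shows "strongly_nil_clean R x \<longleftrightarrow> nilpotent_elem R (x \<ominus> x \<otimes> x)"
proof
  assume "strongly_nil_clean R x"
  then obtain e b where e: "e \<in> carrier R" "e \<otimes> e = e" and b: "nilpotent_elem R b" "b \<in> carrier R"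
    and x_eq: "x = e \<oplus> b" and comm: "e \<otimes> b = b \<otimes> e"
    by (auto simp: strongly_nil_clean_def idempotent_elem_def nilpotent_elem_def)
  let ?s = "\<one> \<ominus> e \<ominus> e \<ominus> b"
  have "x \<ominus> x \<otimes> x = e \<oplus> b \<ominus> (e \<otimes> e \<oplus> e \<otimes> b \<oplus> b \<otimes> e \<oplus> b \<otimes> b)"
    unfolding x_eq using e(1) b(2) by algebra
  also have "\<dots> = b \<ominus> b \<otimes> e \<ominus> b \<otimes> e \<ominus> b \<otimes> b"
    unfolding e(2) comm using e(1) b(2) by algebra
  also have "\<dots> = b \<otimes> ?s"
    using e(1) b(2) by (simp add: a_minus_def r_distr r_minus)
  finally have 1: "x \<ominus> x \<otimes> x = b \<otimes> ?s" .
  have "?s \<otimes> b = b \<ominus> e \<otimes> b \<ominus> e \<otimes> b \<ominus> b \<otimes> b"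
    using e(1) b(2) by algebra
  also have "\<dots> = b \<otimes> ?s"
    unfolding comm using e(1) b(2) by (simp add: a_minus_def r_distr r_minus)
  finally show "nilpotent_elem R (x \<ominus> x \<otimes> x)"
    unfolding 1 using b e by (intro nilpotent_elem_mult) auto
next
  assume nil: "nilpotent_elem R (x \<ominus> x \<otimes> x)"
  let ?t = "x \<ominus> x \<otimes> x"
  obtain e z where e: "idempotent_elem R e" and z: "z \<in> carrier R" and e_eq: "e = x \<oplus> ?t \<otimes> z"
    and comm: "e \<otimes> x = x \<otimes> e" and tz: "?t \<otimes> z = z \<otimes> ?t"
    using lift_idempotent[OF x nil] .
  have ec: "e \<in> carrier R" using e by (simp add: idempotent_elem_def)
  have t: "?t \<in> carrier R" using x by simp
  have "nilpotent_elem R (?t \<otimes> (\<ominus> z))"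
    using nilpotent_elem_mult[OF nil, of "\<ominus> z"] z t tz by (simp add: l_minus r_minus)
  moreover have "x = e \<oplus> ?t \<otimes> (\<ominus> z)"
    unfolding e_eq using x z by algebra
  moreover have "?t \<otimes> (\<ominus> z) = x \<ominus> e"
    unfolding e_eq using x z by algebra
  moreover have "e \<otimes> (x \<ominus> e) = (x \<ominus> e) \<otimes> e"
    using x ec comm by algebra
  ultimately show "strongly_nil_clean R x"
    unfolding strongly_nil_clean_def using e by metis
qed

section \<open>Transfer along a surjection with nil kernel\<close>

locale nil_kernel_hom = ring_hom_ring +
  assumes surj: "h ` carrier R = carrier S"
    and nil_kernel: "\<lbrakk>x \<in> carrier R; h x = \<zero>\<^bsub>S\<^esub>\<rbrakk> \<Longrightarrow> nilpotent_elem R x"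
begin

text \<open>If a power of \<open>h x\<close> vanishes, the same power of \<open>x\<close> lies in
  the kernel and is nilpotent, so \<open>x\<close> is nilpotent too.\<close>

lemma nilpotent_iff:
  assumes "x \<in> carrier R"
  shows "nilpotent_elem S (h x) \<longleftrightarrow> nilpotent_elem R x"
proof
  assume "nilpotent_elem S (h x)"
  then obtain n :: nat where "h x [^]\<^bsub>S\<^esub> n = \<zero>\<^bsub>S\<^esub>"
    by (auto simp: nilpotent_elem_def)
  then have "nilpotent_elem R (x [^] n)"
    using assms by (intro nil_kernel) (auto simp: hom_nat_pow)
  then show "nilpotent_elem R x"
    using assms R.nilpotent_elem_pow by blast
qed (use assms in \<open>auto simp: nilpotent_elem_def hom_nat_pow[symmetric]\<close>)

lemma hom_minus: "\<lbrakk>x \<in> carrier R; y \<in> carrier R\<rbrakk> \<Longrightarrow> h (x \<ominus> y) = h x \<ominus>\<^bsub>S\<^esub> h y"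
  by (simp add: a_minus_def)

text \<open>The element \<open>1 - ab\<close> lies in the kernel, so \<open>ab\<close> is 1 minus a
  nilpotent element.\<close>

lemma unit_of_inverse_image:
  assumes "a \<in> carrier R" "b \<in> carrier R" "h (a \<otimes> b) = \<one>\<^bsub>S\<^esub>"
  shows "a \<otimes> b \<in> Units R"
proof -
  have "nilpotent_elem R (\<one> \<ominus> a \<otimes> b)"
    using assms by (intro nil_kernel) (auto simp: hom_minus a_minus_def S.r_neg simp del: hom_mult)
  then obtain n :: nat where "(\<one> \<ominus> a \<otimes> b) [^] n = \<zero>"
    by (auto simp: nilpotent_elem_def)
  then have "\<one> \<ominus> (\<one> \<ominus> a \<otimes> b) \<in> Units R"
    using assms by (intro R.one_minus_nilpotent_Units) auto
  moreover have "\<one> \<ominus> (\<one> \<ominus> a \<otimes> b) = a \<otimes> b"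
    using assms by algebra
  ultimately show ?thesis by simp
qed

text \<open>Arbitrary preimages of \<open>v\<close> and of its inverse suffice: both of their
  products map to 1 and are therefore units.\<close>

lemma lift_unit:
  assumes "v \<in> Units S"
  obtains u where "u \<in> Units R" "h u = v"
proof -
  obtain u where u: "u \<in> carrier R" "h u = v"
    using assms surj by (metis S.Units_closed imageE)
  obtain w where w: "w \<in> carrier R" "h w = inv\<^bsub>S\<^esub> v"
    using assms surj by (metis S.Units_inv_closed imageE)
  have "u \<otimes> w \<in> Units R" "w \<otimes> u \<in> Units R"
    using u w assms by (auto intro!: unit_of_inverse_image)
  then show ?thesis
    using that[OF _ u(2)] R.Units_if_mult_Units[OF u(1) w(1)] by simp
qed

lemma hom_unit: "u \<in> Units R \<Longrightarrow> h u \<in> Units S"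
  using hom_mult[of u "inv u"] hom_mult[of "inv u" u]
  by (intro S.Units_if_mult_Units[of "h u" "h (inv u)"])
    (simp_all add: R.Units_closed del: hom_mult flip: hom_mult)

text \<open>A preimage \<open>a\<close> of \<open>e\<close> has its defect in the kernel, so the
  correction turning \<open>a\<close> into an idempotent \<open>f\<close> is invisible to
  \<open>h\<close>. The nilpotent part is then taken to be \<open>x - f\<close>, a preimage of
  \<open>b\<close>. Nothing here makes \<open>f\<close> commute with \<open>x\<close>, so the strong
  version takes another route.\<close>

lemma nil_clean_iff:
  assumes x: "x \<in> carrier R"
  shows "nil_clean S (h x) \<longleftrightarrow> nil_clean R x"
proof
  assume "nil_clean S (h x)"
  then obtain e b where e: "e \<in> carrier S" "e \<otimes>\<^bsub>S\<^esub> e = e" and b: "nilpotent_elem S b"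
    and eq: "h x = e \<oplus>\<^bsub>S\<^esub> b"
    by (auto simp: nil_clean_def idempotent_elem_def)
  obtain a where a: "a \<in> carrier R" "h a = e"
    using e surj by (metis imageE)
  have 0: "h (a \<ominus> a \<otimes> a) = \<zero>\<^bsub>S\<^esub>"
    using a e by (simp add: hom_minus a_minus_def S.r_neg)
  then have "nilpotent_elem R (a \<ominus> a \<otimes> a)"
    using a by (intro nil_kernel) auto
  from R.lift_idempotent[OF a(1) this] obtain f z
    where f: "idempotent_elem R f" and z: "z \<in> carrier R" and f_eq: "f = a \<oplus> (a \<ominus> a \<otimes> a) \<otimes> z" .
  have fc: "f \<in> carrier R" using f by (simp add: idempotent_elem_def)
  have "h f = h a \<oplus>\<^bsub>S\<^esub> h (a \<ominus> a \<otimes> a) \<otimes>\<^bsub>S\<^esub> h z"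
    unfolding f_eq using a z by simp
  then have "h f = e"
    using 0 a z e(1) by simp
  have bc: "b \<in> carrier S" using b by (simp add: nilpotent_elem_def)
  have "h (x \<ominus> f) = b"
    using x fc eq e(1) bc \<open>h f = e\<close>
    by (simp add: hom_minus a_minus_def S.a_comm[of e b] S.a_assoc S.r_neg)
  then have "nilpotent_elem R (x \<ominus> f)"
    using nilpotent_iff[of "x \<ominus> f"] b x fc by simp
  moreover have "x = f \<oplus> (x \<ominus> f)"
    using x fc by algebra
  ultimately show "nil_clean R x"
    using f unfolding nil_clean_def by blast
next
  assume "nil_clean R x"
  then obtain e b where e: "e \<in> carrier R" "e \<otimes> e = e" and b: "nilpotent_elem R b" "b \<in> carrier R"
    and eq: "x = e \<oplus> b"
    by (auto simp: nil_clean_def idempotent_elem_def nilpotent_elem_def)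
  have "h e \<otimes>\<^bsub>S\<^esub> h e = h e"
    using e hom_mult[of e e] by simp
  then have "idempotent_elem S (h e)"
    using e by (simp add: idempotent_elem_def)
  moreover have "nilpotent_elem S (h b)"
    using nilpotent_iff b by simp
  ultimately show "nil_clean S (h x)"
    using eq e(1) b(2) unfolding nil_clean_def by auto
qed

lemma strongly_nil_clean_iff:
  assumes x: "x \<in> carrier R"
  shows "strongly_nil_clean S (h x) \<longleftrightarrow> strongly_nil_clean R x"
  using x nilpotent_iff[of "x \<ominus> x \<otimes> x"]
  by (simp add: R.strongly_nil_clean_iff S.strongly_nil_clean_iff hom_minus)

text \<open>The quantifier exchange common to both properties: ring elements lift by surjectivity,
  units by \<open>lift_unit\<close>.\<close>

lemma ball_bex_unit_iff:
  assumes "\<And>x. x \<in> carrier R \<Longrightarrow> Q (h x) \<longleftrightarrow> P x"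
  shows "(\<forall>a \<in> carrier S. \<exists>u \<in> Units S. Q (u \<otimes>\<^bsub>S\<^esub> a)) \<longleftrightarrow>
    (\<forall>a \<in> carrier R. \<exists>u \<in> Units R. P (u \<otimes> a))" (is "?L \<longleftrightarrow> ?R")
proof
  assume L: ?L
  show ?R
  proof
    fix a assume a: "a \<in> carrier R"
    then obtain v where v: "v \<in> Units S" "Q (v \<otimes>\<^bsub>S\<^esub> h a)"
      using L hom_closed by blast
    obtain u where u: "u \<in> Units R" "h u = v"
      using lift_unit[OF v(1)] .
    then have "P (u \<otimes> a)"
      using v a assms[of "u \<otimes> a"] by (simp add: R.Units_closed)
    then show "\<exists>u \<in> Units R. P (u \<otimes> a)"
      using u by blast
  qed
next
  assume R: ?R
  show ?L
  proof
    fix b assume "b \<in> carrier S"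
    then obtain a where a: "a \<in> carrier R" "h a = b"
      using surj by (metis imageE)
    then obtain u where u: "u \<in> Units R" "P (u \<otimes> a)"
      using R by blast
    then have "Q (h u \<otimes>\<^bsub>S\<^esub> b)"
      using a assms[of "u \<otimes> a"] by (simp add: R.Units_closed)
    then show "\<exists>u \<in> Units S. Q (u \<otimes>\<^bsub>S\<^esub> b)"
      using u hom_unit by blast
  qed
qed

lemma unit_nil_clean_iff: "unit_nil_clean S \<longleftrightarrow> unit_nil_clean R"
  unfolding unit_nil_clean_def by (intro ball_bex_unit_iff nil_clean_iff)

lemma strongly_unit_nil_clean_iff: "strongly_unit_nil_clean S \<longleftrightarrow> strongly_unit_nil_clean R"
  unfolding strongly_unit_nil_clean_def by (intro ball_bex_unit_iff strongly_nil_clean_iff)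

end

section \<open>Products of two rings\<close>

lemma RDirProd_ops:
  "(a, b) \<otimes>\<^bsub>RDirProd R S\<^esub> (c, d) = (a \<otimes>\<^bsub>R\<^esub> c, b \<otimes>\<^bsub>S\<^esub> d)"
  "(a, b) \<oplus>\<^bsub>RDirProd R S\<^esub> (c, d) = (a \<oplus>\<^bsub>R\<^esub> c, b \<oplus>\<^bsub>S\<^esub> d)"
  "\<one>\<^bsub>RDirProd R S\<^esub> = (\<one>\<^bsub>R\<^esub>, \<one>\<^bsub>S\<^esub>)" "\<zero>\<^bsub>RDirProd R S\<^esub> = (\<zero>\<^bsub>R\<^esub>, \<zero>\<^bsub>S\<^esub>)"
  by (simp_all add: RDirProd_def DirProd_def monoid.defs)

lemma RDirProd_nat_pow: "(a, b) [^]\<^bsub>RDirProd R S\<^esub> (n::nat) = (a [^]\<^bsub>R\<^esub> n, b [^]\<^bsub>S\<^esub> n)"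
  by (induction n) (simp_all add: nat_pow_def RDirProd_ops)

lemma RDirProd_Units: "Units (RDirProd R S) = Units R \<times> Units S"
  by (auto simp: Units_def RDirProd_carrier RDirProd_ops) blast

lemma RDirProd_idempotent:
  "idempotent_elem (RDirProd R S) (a, b) \<longleftrightarrow> idempotent_elem R a \<and> idempotent_elem S b"
  by (auto simp: idempotent_elem_def RDirProd_carrier RDirProd_ops)

lemma RDirProd_nilpotent:
  assumes "ring R" "ring S"
  shows "nilpotent_elem (RDirProd R S) (a, b) \<longleftrightarrow> nilpotent_elem R a \<and> nilpotent_elem S b"
proof
  assume "nilpotent_elem (RDirProd R S) (a, b)"
  then show "nilpotent_elem R a \<and> nilpotent_elem S b"
    by (auto simp: nilpotent_elem_def RDirProd_carrier RDirProd_nat_pow RDirProd_ops)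
next
  assume ab: "nilpotent_elem R a \<and> nilpotent_elem S b"
  then obtain m n :: nat where a: "a \<in> carrier R" "m > 0" "a [^]\<^bsub>R\<^esub> m = \<zero>\<^bsub>R\<^esub>"
    and b: "b \<in> carrier S" "n > 0" "b [^]\<^bsub>S\<^esub> n = \<zero>\<^bsub>S\<^esub>"
    by (auto simp: nilpotent_elem_def)
  have "a [^]\<^bsub>R\<^esub> (m + n) = \<zero>\<^bsub>R\<^esub>" "b [^]\<^bsub>S\<^esub> (m + n) = \<zero>\<^bsub>S\<^esub>"
    using ring.nat_pow_zero_ge[OF assms(1) a(1,3)] ring.nat_pow_zero_ge[OF assms(2) b(1,3)] by simp_all
  then have "(a, b) [^]\<^bsub>RDirProd R S\<^esub> (m + n) = \<zero>\<^bsub>RDirProd R S\<^esub>"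
    by (simp add: RDirProd_nat_pow RDirProd_ops)
  then show "nilpotent_elem (RDirProd R S) (a, b)"
    using a b unfolding nilpotent_elem_def RDirProd_carrier by (metis SigmaI add_gr_0)
qed

lemma RDirProd_nil_clean:
  assumes "ring R" "ring S"
  shows "nil_clean (RDirProd R S) (a, b) \<longleftrightarrow> nil_clean R a \<and> nil_clean S b"
  unfolding nil_clean_def split_paired_Ex
  using assms by (simp add: RDirProd_nilpotent RDirProd_idempotent RDirProd_ops) blast

lemma RDirProd_strongly_nil_clean:
  assumes "ring R" "ring S"
  shows "strongly_nil_clean (RDirProd R S) (a, b) \<longleftrightarrow> strongly_nil_clean R a \<and> strongly_nil_clean S b"
  unfolding strongly_nil_clean_def split_paired_Ex
  using assms by (simp add: RDirProd_nilpotent RDirProd_idempotent RDirProd_ops) blast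

lemma RDirProd_unit_nil_clean:
  assumes "ring R" "ring S"
  shows "unit_nil_clean (RDirProd R S) \<longleftrightarrow> unit_nil_clean R \<and> unit_nil_clean S"
proof -
  \<comment> \<open>To pass from the product to one factor, an element of that factor is completed
    to a pair by some element of the other.\<close>
  have "carrier R \<noteq> {}" "carrier S \<noteq> {}"
    using assms ring.ring_simprules(6) by blast+
  then show ?thesis
    using assms unfolding unit_nil_clean_def RDirProd_carrier RDirProd_Units Ball_def Bex_def
      split_paired_All split_paired_Ex
    by (simp add: RDirProd_ops RDirProd_nil_clean) blast
qed

lemma RDirProd_strongly_unit_nil_clean:
  assumes "ring R" "ring S"
  shows "strongly_unit_nil_clean (RDirProd R S) \<longleftrightarrow> strongly_unit_nil_clean R \<and> strongly_unit_nil_clean S"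
proof -
  have "carrier R \<noteq> {}" "carrier S \<noteq> {}"
    using assms ring.ring_simprules(6) by blast+
  then show ?thesis
    using assms unfolding strongly_unit_nil_clean_def RDirProd_carrier RDirProd_Units Ball_def Bex_def
      split_paired_All split_paired_Ex
    by (simp add: RDirProd_ops RDirProd_strongly_nil_clean) blast
qed

section \<open>The pairing induced by a tensor homomorphism\<close>

lemma tensor_relationsI:
  "\<lbrakk>m \<in> carrier M; m' \<in> carrier M; n \<in> carrier N\<rbrakk> \<Longrightarrow>
    frag_of (m \<oplus>\<^bsub>M\<^esub> m', n) - frag_of (m, n) - frag_of (m', n) \<in> tensor_relations B M N"
  "\<lbrakk>m \<in> carrier M; n \<in> carrier N; n' \<in> carrier N\<rbrakk> \<Longrightarrow>
    frag_of (m, n \<oplus>\<^bsub>N\<^esub> n') - frag_of (m, n) - frag_of (m, n') \<in> tensor_relations B M N"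
  "\<lbrakk>m \<in> carrier M; b \<in> carrier B; n \<in> carrier N\<rbrakk> \<Longrightarrow>
    frag_of (m \<triangleleft>\<^bsub>M\<^esub> b, n) - frag_of (m, b \<triangleright>\<^bsub>N\<^esub> n) \<in> tensor_relations B M N"
  unfolding tensor_relations_def by blast+

lemma tensor_relationsE:
  assumes "x \<in> tensor_relations B M N"
  obtains (add_left) m m' n where "m \<in> carrier M" "m' \<in> carrier M" "n \<in> carrier N"
      "x = frag_of (m \<oplus>\<^bsub>M\<^esub> m', n) - frag_of (m, n) - frag_of (m', n)"
    | (add_right) m n n' where "m \<in> carrier M" "n \<in> carrier N" "n' \<in> carrier N"
      "x = frag_of (m, n \<oplus>\<^bsub>N\<^esub> n') - frag_of (m, n) - frag_of (m, n')"
    | (balanced) m b n where "m \<in> carrier M" "b \<in> carrier B" "n \<in> carrier N"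
      "x = frag_of (m \<triangleleft>\<^bsub>M\<^esub> b, n) - frag_of (m, b \<triangleright>\<^bsub>N\<^esub> n)"
  using assms unfolding tensor_relations_def by blast

lemma keys_frag_of_diff:
  "a \<in> S \<Longrightarrow> b \<in> S \<Longrightarrow> Poly_Mapping.keys (frag_of a - frag_of b) \<subseteq> S"
  "a \<in> S \<Longrightarrow> b \<in> S \<Longrightarrow> c \<in> S \<Longrightarrow> Poly_Mapping.keys (frag_of a - frag_of b - frag_of c) \<subseteq> S"
  using keys_diff[of "frag_of a" "frag_of b"] keys_diff[of "frag_of a - frag_of b" "frag_of c"]
  by (auto simp: keys_frag_of)

lemma (in ring) minus_minus_zeroD:
  assumes "a \<in> carrier R" "b \<in> carrier R" "c \<in> carrier R" "a \<ominus> b \<ominus> c = \<zero>"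
  shows "a = b \<oplus> c"
proof -
  have "a = (a \<ominus> b \<ominus> c) \<oplus> (b \<oplus> c)"
    using assms(1-3) by algebra
  then show ?thesis
    using assms by simp
qed

text \<open>One half of a Morita context. A second instance with \<open>A\<close>, \<open>B\<close>
  and \<open>M\<close>, \<open>N\<close> exchanged gives the other pairing without repeating any
  argument.\<close>

locale tensor_hom = M?: bimodule A B M + N?: bimodule B A N
  for A :: "('a, 'x) ring_scheme" (structure) and B :: "('b, 'y) ring_scheme" (structure)
    and M :: "('a, 'b, 'm, 'v) bimodule_scheme" (structure)
    and N :: "('b, 'a, 'n, 'w) bimodule_scheme" (structure) +
  fixes \<phi> :: "('m \<times> 'n \<Rightarrow>\<^sub>0 int) set \<Rightarrow> 'a"
  assumes phi: "\<phi> \<in> bimodule_hom A A (tensor_product B M N) (regular_bimodule A)"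
begin

abbreviation F where "F \<equiv> tensor_free M N"
abbreviation K where "K \<equiv> tensor_kernel B M N"

definition pairing :: "'m \<Rightarrow> 'n \<Rightarrow> 'a"
  where "pairing m n = \<phi> (pure_tensor B M N m n)"

lemma tensor_relations_subset: "tensor_relations B M N \<subseteq> carrier F"
proof
  fix x assume "x \<in> tensor_relations B M N"
  then show "x \<in> carrier F"
    by (cases rule: tensor_relationsE)
      (simp_all add: keys_frag_of_diff ract_closed lact_closed M.ract_closed N.lact_closed)
qed

lemma tensor_kernel_normal: "K \<lhd> F"
  unfolding tensor_kernel_def
  by (intro comm_group.subgroup_imp_normal[OF abelian_free_Abelian_group]
      group.generate_is_subgroup[OF group_free_Abelian_group tensor_relations_subset])

lemma tensor_kernel_subgroup: "subgroup K F"
  using tensor_kernel_normal by (rule normal_imp_subgroup)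

text \<open>The composite of \<phi> with the projection from the free abelian group. It is additive
  and kills each tensor relation, so each relation becomes an identity for
  \<open>pairing\<close>.\<close>

definition lift :: "('m \<times> 'n \<Rightarrow>\<^sub>0 int) \<Rightarrow> 'a"
  where "lift x = \<phi> (K #>\<^bsub>F\<^esub> x)"

lemma lift_hom: "group_hom F (add_monoid A) lift"
proof -
  have "\<phi> \<in> hom (F Mod K) (add_monoid A)"
    using phi by (simp add: bimodule_hom_def tensor_product_def regular_bimodule_def hom_def)
  from hom_compose[OF normal.r_coset_hom_Mod[OF tensor_kernel_normal] this]
  show ?thesis
    unfolding group_hom_def group_hom_axioms_def lift_def comp_def
    using A.add.is_group by simp
qed

lemma pairing_eq_lift: "pairing m n = lift (frag_of (m, n))"
  by (simp add: pairing_def lift_def pure_tensor_def)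

lemma lift_kernel:
  assumes "x \<in> K"
  shows "lift x = \<zero>\<^bsub>A\<^esub>"
proof -
  have K_coset: "K #>\<^bsub>F\<^esub> y = K" if "y \<in> K" for y
    using group.coset_join2[OF group_free_Abelian_group _ tensor_kernel_subgroup that]
      subgroup.mem_carrier[OF tensor_kernel_subgroup that] by blast
  have "lift x = lift \<one>\<^bsub>F\<^esub>"
    unfolding lift_def using K_coset[OF assms] K_coset[OF subgroup.one_closed[OF tensor_kernel_subgroup]]
    by (rule arg_cong[OF trans[OF _ sym]])
  also have "\<dots> = \<zero>\<^bsub>A\<^esub>"
    using group_hom.hom_one[OF lift_hom] by simp
  finally show ?thesis .
qed

lemma lift_relation: "x \<in> tensor_relations B M N \<Longrightarrow> lift x = \<zero>\<^bsub>A\<^esub>"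
  by (rule lift_kernel) (simp add: tensor_kernel_def generate.incl)

lemma lift_diff:
  assumes "x \<in> carrier F" "y \<in> carrier F"
  shows "lift (x - y) = lift x \<ominus>\<^bsub>A\<^esub> lift y"
proof -
  have "lift (x \<otimes>\<^bsub>F\<^esub> inv\<^bsub>F\<^esub> y) = lift x \<oplus>\<^bsub>A\<^esub> inv\<^bsub>add_monoid A\<^esub> lift y"
    using assms group_hom.hom_mult[OF lift_hom, of x "inv\<^bsub>F\<^esub> y"] group_hom.hom_inv[OF lift_hom, of y]
      group.inv_closed[OF group_free_Abelian_group, of y] by (simp del: add_uminus_conv_diff)
  then show ?thesis
    using assms by (simp add: a_minus_def a_inv_def)
qed

lemma lift_closed: "x \<in> carrier F \<Longrightarrow> lift x \<in> carrier A"
  using group_hom.hom_closed[OF lift_hom] by simp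

lemma pairing_closed: "\<lbrakk>m \<in> carrier M; n \<in> carrier N\<rbrakk> \<Longrightarrow> pairing m n \<in> carrier A"
  unfolding pairing_eq_lift by (intro lift_closed) simp

lemma pairing_add_left:
  assumes "m \<in> carrier M" "m' \<in> carrier M" "n \<in> carrier N"
  shows "pairing (m \<oplus>\<^bsub>M\<^esub> m') n = pairing m n \<oplus>\<^bsub>A\<^esub> pairing m' n"
proof -
  have "pairing (m \<oplus>\<^bsub>M\<^esub> m') n \<ominus>\<^bsub>A\<^esub> pairing m n \<ominus>\<^bsub>A\<^esub> pairing m' n = \<zero>\<^bsub>A\<^esub>"
    using lift_relation[OF tensor_relationsI(1)[OF assms]] assms
    by (simp add: lift_diff keys_frag_of_diff pairing_eq_lift)
  then show ?thesis
    using A.minus_minus_zeroD pairing_closed assms by simp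
qed

lemma pairing_add_right:
  assumes "m \<in> carrier M" "n \<in> carrier N" "n' \<in> carrier N"
  shows "pairing m (n \<oplus>\<^bsub>N\<^esub> n') = pairing m n \<oplus>\<^bsub>A\<^esub> pairing m n'"
proof -
  have "pairing m (n \<oplus>\<^bsub>N\<^esub> n') \<ominus>\<^bsub>A\<^esub> pairing m n \<ominus>\<^bsub>A\<^esub> pairing m n' = \<zero>\<^bsub>A\<^esub>"
    using lift_relation[OF tensor_relationsI(2)[OF assms]] assms
    by (simp add: lift_diff keys_frag_of_diff pairing_eq_lift)
  then show ?thesis
    using A.minus_minus_zeroD pairing_closed assms by simp
qed

lemma pairing_balanced:
  assumes "m \<in> carrier M" "b \<in> carrier B" "n \<in> carrier N"
  shows "pairing (m \<triangleleft>\<^bsub>M\<^esub> b) n = pairing m (b \<triangleright>\<^bsub>N\<^esub> n)"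
proof -
  have "pairing (m \<triangleleft>\<^bsub>M\<^esub> b) n \<ominus>\<^bsub>A\<^esub> pairing m (b \<triangleright>\<^bsub>N\<^esub> n) = \<zero>\<^bsub>A\<^esub>"
    using lift_relation[OF tensor_relationsI(3)[OF assms]] assms
    by (simp add: lift_diff keys_frag_of_diff pairing_eq_lift M.ract_closed N.lact_closed)
  then show ?thesis
    using pairing_closed assms M.ract_closed N.lact_closed by (metis A.r_right_minus_eq)
qed

text \<open>Unwinds the encoding of the outer actions on cosets: as soon as the extension of
  \<open>g\<close> sends the relations into \<open>K\<close>, the action on a coset can be computed
  on any representative.\<close>

lemma frag_extend_coset:
  assumes g: "\<And>p. p \<in> carrier M \<times> carrier N \<Longrightarrow> g p \<in> carrier F"
    and rel: "\<And>x. x \<in> tensor_relations B M N \<Longrightarrow> frag_extend g x \<in> K"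
    and x: "x \<in> carrier F"
  shows "K <#>\<^bsub>F\<^esub> frag_extend g ` (K #>\<^bsub>F\<^esub> x) = K #>\<^bsub>F\<^esub> frag_extend g x"
proof -
  have closed: "frag_extend g y \<in> carrier F" if "y \<in> carrier F" for y
  proof -
    have "Poly_Mapping.keys (g p) \<subseteq> carrier M \<times> carrier N" if "p \<in> Poly_Mapping.keys y" for p
      using g[of p] that \<open>y \<in> carrier F\<close> by auto
    then have "(\<Union>p \<in> Poly_Mapping.keys y. Poly_Mapping.keys (g p)) \<subseteq> carrier M \<times> carrier N"
      by (rule UN_least)
    then show ?thesis
      using order_trans[OF keys_frag_extend[of g y]] by simp
  qed
  have hom: "group_hom F F (frag_extend g)"
    unfolding group_hom_def group_hom_axioms_def
    using closed by (auto simp: hom_def frag_extend_add)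
  \<comment> \<open>The image of a generated subgroup is generated by the images of the generators,
    so looking at the relations is enough.\<close>
  have K: "frag_extend g ` K \<subseteq> K"
    using group_hom.generate_img[OF hom tensor_relations_subset] rel
      group.generate_subgroup_incl[OF group_free_Abelian_group _ tensor_kernel_subgroup, of "frag_extend g ` tensor_relations B M N"]
    unfolding tensor_kernel_def by blast
  have K0: "0 \<in> K"
    using subgroup.one_closed[OF tensor_kernel_subgroup] by simp
  have K_add: "a + b \<in> K" if "a \<in> K" "b \<in> K" for a b
    using subgroup.m_closed[OF tensor_kernel_subgroup that] by simp
  show ?thesis
  proof (intro equalityI subsetI)
    fix y assume "y \<in> K <#>\<^bsub>F\<^esub> frag_extend g ` (K #>\<^bsub>F\<^esub> x)"
    then obtain a b where "a \<in> K" "b \<in> K" "y = a + frag_extend g (b + x)"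
      by (auto simp: set_mult_def r_coset_def)
    then have "a + frag_extend g b \<in> K" "y = (a + frag_extend g b) + frag_extend g x"
      using K K_add by (auto simp: frag_extend_add)
    then show "y \<in> K #>\<^bsub>F\<^esub> frag_extend g x"
      by (auto simp: r_coset_def)
  next
    fix y assume "y \<in> K #>\<^bsub>F\<^esub> frag_extend g x"
    then obtain a where "a \<in> K" "y = a + frag_extend g (0 + x)"
      by (auto simp: r_coset_def)
    moreover have "0 + x \<in> K #>\<^bsub>F\<^esub> x"
      using K0 unfolding r_coset_def by (intro UN_I[of 0]) simp_all
    ultimately show "y \<in> K <#>\<^bsub>F\<^esub> frag_extend g ` (K #>\<^bsub>F\<^esub> x)"
      unfolding set_mult_def by auto
  qed
qed

lemma pure_tensor_in_carrier:
  "\<lbrakk>m \<in> carrier M; n \<in> carrier N\<rbrakk> \<Longrightarrow> pure_tensor B M N m n \<in> carrier (tensor_product B M N)"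
  by (auto simp: pure_tensor_def tensor_product_def FactGroup_def RCOSETS_def)

text \<open>Acting on the left factor turns each tensor relation into one of the same kind; for
  balancedness this is the associativity law \<open>lact_ract\<close>. Hence the action is the
  expected one on pure tensors, and linearity of \<phi> gives the claim.\<close>

lemma pairing_lact:
  assumes a: "a \<in> carrier A" and m: "m \<in> carrier M" and n: "n \<in> carrier N"
  shows "pairing (a \<triangleright>\<^bsub>M\<^esub> m) n = a \<otimes>\<^bsub>A\<^esub> pairing m n"
proof -
  let ?g = "\<lambda>(m, n). frag_of (a \<triangleright>\<^bsub>M\<^esub> m, n)"
  have "frag_extend ?g x \<in> K" if "x \<in> tensor_relations B M N" for x
    unfolding tensor_kernel_def using that
  proof (intro generate.incl, cases rule: tensor_relationsE)
    case (add_left m m' n)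
    then show "frag_extend ?g x \<in> tensor_relations B M N"
      using a tensor_relationsI(1)[of "a \<triangleright>\<^bsub>M\<^esub> m" M "a \<triangleright>\<^bsub>M\<^esub> m'"]
      by (simp add: frag_extend_diff M.lact_r_distr M.lact_closed)
  next
    case (add_right m n n')
    then show "frag_extend ?g x \<in> tensor_relations B M N"
      using a tensor_relationsI(2)[of "a \<triangleright>\<^bsub>M\<^esub> m" M]
      by (simp add: frag_extend_diff M.lact_closed)
  next
    case (balanced m b n)
    then show "frag_extend ?g x \<in> tensor_relations B M N"
      using a tensor_relationsI(3)[of "a \<triangleright>\<^bsub>M\<^esub> m" M b B n N]
      by (simp add: frag_extend_diff M.lact_closed M.lact_ract)
  qed
  then have "lact (tensor_product B M N) a (pure_tensor B M N m n) = pure_tensor B M N (a \<triangleright>\<^bsub>M\<^esub> m) n"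
    using frag_extend_coset[of ?g "frag_of (m, n)"] a m n
    by (auto simp: tensor_product_def pure_tensor_def M.lact_closed)
  moreover have "\<phi> (lact (tensor_product B M N) a (pure_tensor B M N m n)) = a \<otimes>\<^bsub>A\<^esub> pairing m n"
    using phi a pure_tensor_in_carrier[OF m n] by (simp add: bimodule_hom_def regular_bimodule_def pairing_def)
  ultimately show ?thesis
    by (simp add: pairing_def)
qed

lemma pairing_ract:
  assumes a: "a \<in> carrier A" and m: "m \<in> carrier M" and n: "n \<in> carrier N"
  shows "pairing m (n \<triangleleft>\<^bsub>N\<^esub> a) = pairing m n \<otimes>\<^bsub>A\<^esub> a"
proof -
  let ?g = "\<lambda>(m, n). frag_of (m, n \<triangleleft>\<^bsub>N\<^esub> a)"
  have "frag_extend ?g x \<in> K" if "x \<in> tensor_relations B M N" for x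
    unfolding tensor_kernel_def using that
  proof (intro generate.incl, cases rule: tensor_relationsE)
    case (add_left m m' n)
    then show "frag_extend ?g x \<in> tensor_relations B M N"
      using a tensor_relationsI(1)[of m M m' "n \<triangleleft>\<^bsub>N\<^esub> a" N]
      by (simp add: frag_extend_diff N.ract_closed)
  next
    case (add_right m n n')
    then show "frag_extend ?g x \<in> tensor_relations B M N"
      using a tensor_relationsI(2)[of m M "n \<triangleleft>\<^bsub>N\<^esub> a" N "n' \<triangleleft>\<^bsub>N\<^esub> a"]
      by (simp add: frag_extend_diff N.ract_closed N.ract_l_distr)
  next
    case (balanced m b n)
    then show "frag_extend ?g x \<in> tensor_relations B M N"
      using a tensor_relationsI(3)[of m M b B "n \<triangleleft>\<^bsub>N\<^esub> a" N]
      by (simp add: frag_extend_diff N.ract_closed N.lact_ract)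
  qed
  then have "ract (tensor_product B M N) (pure_tensor B M N m n) a = pure_tensor B M N m (n \<triangleleft>\<^bsub>N\<^esub> a)"
    using frag_extend_coset[of ?g "frag_of (m, n)"] a m n
    by (auto simp: tensor_product_def pure_tensor_def N.ract_closed)
  moreover have "\<phi> (ract (tensor_product B M N) (pure_tensor B M N m n) a) = pairing m n \<otimes>\<^bsub>A\<^esub> a"
    using phi a pure_tensor_in_carrier[OF m n] by (simp add: bimodule_hom_def regular_bimodule_def pairing_def)
  ultimately show ?thesis
    by (simp add: pairing_def)
qed

lemma pairing_zero_left: "n \<in> carrier N \<Longrightarrow> pairing \<zero>\<^bsub>M\<^esub> n = \<zero>\<^bsub>A\<^esub>"
  using pairing_add_left[of "\<zero>\<^bsub>M\<^esub>" "\<zero>\<^bsub>M\<^esub>" n] pairing_closed[of "\<zero>\<^bsub>M\<^esub>" n] by simp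

lemma pairing_zero_right: "m \<in> carrier M \<Longrightarrow> pairing m \<zero>\<^bsub>N\<^esub> = \<zero>\<^bsub>A\<^esub>"
  using pairing_add_right[of m "\<zero>\<^bsub>N\<^esub>" "\<zero>\<^bsub>N\<^esub>"] pairing_closed[of m "\<zero>\<^bsub>N\<^esub>"] by simp

lemma pairing_minus_left:
  assumes "m \<in> carrier M" "n \<in> carrier N"
  shows "pairing (\<ominus>\<^bsub>M\<^esub> m) n = \<ominus>\<^bsub>A\<^esub> pairing m n"
  using assms pairing_add_left[of "\<ominus>\<^bsub>M\<^esub> m" m n] pairing_zero_left[of n] pairing_closed
  by (simp add: M.V.l_neg A.minus_equality)

abbreviation trace_ideal where "trace_ideal \<equiv> \<phi> ` carrier (tensor_product B M N)"

lemma trace_ideal_eq: "trace_ideal = lift ` carrier F"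
  by (auto simp: tensor_product_def FactGroup_def RCOSETS_def lift_def)

lemma pairing_in_trace_ideal: "\<lbrakk>m \<in> carrier M; n \<in> carrier N\<rbrakk> \<Longrightarrow> pairing m n \<in> trace_ideal"
  unfolding pairing_def using pure_tensor_in_carrier by blast

text \<open>Every element of the trace ideal is a sum of pairings; signs are absorbed by
  \<open>-(mn) = (-m)n\<close>.\<close>

lemma trace_ideal_induct [consumes 1, case_names pairing add]:
  assumes "a \<in> trace_ideal"
    and pairing: "\<And>m n. \<lbrakk>m \<in> carrier M; n \<in> carrier N\<rbrakk> \<Longrightarrow> P (pairing m n)"
    and add: "\<And>a b. \<lbrakk>a \<in> carrier A; b \<in> carrier A; P a; P b\<rbrakk> \<Longrightarrow> P (a \<oplus>\<^bsub>A\<^esub> b)"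
  shows "P a"
proof -
  obtain x where x: "x \<in> carrier F" "a = lift x"
    using assms(1) unfolding trace_ideal_eq by (rule imageE)
  have "Poly_Mapping.keys x \<subseteq> carrier M \<times> carrier N"
    using x by simp
  \<comment> \<open>Induction on the free abelian group builds elements by differences, whereas
    \<open>P\<close> is only closed under sums. So the claim carries \<open>P\<close> for the
    negative as well.\<close>
  then have "x \<in> carrier F \<and> P (lift x) \<and> P (\<ominus>\<^bsub>A\<^esub> lift x)"
  proof (induction x rule: frag_induction)
    case zero
    have "lift 0 = pairing \<zero>\<^bsub>M\<^esub> \<zero>\<^bsub>N\<^esub>" "\<ominus>\<^bsub>A\<^esub> lift 0 = pairing \<zero>\<^bsub>M\<^esub> \<zero>\<^bsub>N\<^esub>"
      using group_hom.hom_one[OF lift_hom] by (simp_all add: pairing_zero_left)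
    then show ?case
      using pairing[of "\<zero>\<^bsub>M\<^esub>" "\<zero>\<^bsub>N\<^esub>"] by simp
  next
    case (one p)
    then show ?case
      using pairing pairing_minus_left[symmetric]
      by (auto simp: pairing_eq_lift[symmetric])
  next
    case (diff x y)
    have closed: "lift x \<in> carrier A" "lift y \<in> carrier A"
      using diff lift_closed by blast+
    have "x - y \<in> carrier F"
      using diff keys_diff[of x y] by auto
    moreover have "lift (x - y) = lift x \<oplus>\<^bsub>A\<^esub> \<ominus>\<^bsub>A\<^esub> lift y"
      "\<ominus>\<^bsub>A\<^esub> lift (x - y) = \<ominus>\<^bsub>A\<^esub> lift x \<oplus>\<^bsub>A\<^esub> lift y"
      using diff closed by (simp_all add: lift_diff a_minus_def A.minus_add)
    ultimately show ?case
      using add diff closed by simp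
  qed
  then show ?thesis using x by simp
qed

end

section \<open>Morita context rings\<close>

lemma ideals_set_ops:
  "\<one>\<^bsub>ideals_set R\<^esub> = carrier R" "I \<otimes>\<^bsub>ideals_set R\<^esub> J = ideal_prod R I J"
  by (simp_all add: ideals_set_def)

lemma (in ring) ideal_pow_ideal:
  "ideal I R \<Longrightarrow> ideal (I [^]\<^bsub>ideals_set R\<^esub> (k::nat)) R"
  by (induction k) (simp_all add: ideals_set_ops oneideal ideal_prod_is_ideal)

lemma (in ring) nat_pow_in_ideal_pow:
  assumes "ideal I R" "x \<in> I"
  shows "x [^] k \<in> I [^]\<^bsub>ideals_set R\<^esub> (k::nat)"
  using assms by (induction k) (simp_all add: ideals_set_ops ideal_prod.prod)

lemma (in ring) nilpotent_ideal_elem: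
  assumes "nilpotent_ideal R I" "x \<in> I"
  shows "nilpotent_elem R x"
proof -
  obtain n :: nat where I: "ideal I R" and n: "I [^]\<^bsub>ideals_set R\<^esub> n = {\<zero>}"
    using assms(1) by (auto simp: nilpotent_ideal_def)
  have "x [^] n = \<zero>"
    using nat_pow_in_ideal_pow[OF I assms(2), of n] n by simp
  then show ?thesis
    using ideal.Icarr[OF I assms(2)] by (intro nilpotent_elemI)
qed

lemma (in ideal) rcos_zero_iff:
  assumes "x \<in> carrier R"
  shows "I +> x = \<zero>\<^bsub>R Quot I\<^esub> \<longleftrightarrow> x \<in> I"
  using assms a_rcos_const a_rcos_self by (auto simp: FactRing_def)

lemma (in ideal) rcos_surj: "(+>) I ` carrier R = carrier (R Quot I)"
  by (auto simp: FactRing_def A_RCOSETS_def')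

lemma (in ring) nilpotent_ideal_quotient:
  assumes "nilpotent_ideal R I"
  shows "nil_kernel_hom R (R Quot I) ((+>) I)"
proof -
  interpret I: ideal I R
    using assms by (simp add: nilpotent_ideal_def)
  show ?thesis
    using I.rcos_ring_hom_ring I.rcos_surj I.rcos_zero_iff nilpotent_ideal_elem[OF assms]
    by (simp add: nil_kernel_hom_def nil_kernel_hom_axioms_def)
qed

context bimodule
begin

lemma lact_zero_left: "x \<in> carrier V \<Longrightarrow> \<zero>\<^bsub>A\<^esub> \<triangleright>\<^bsub>V\<^esub> x = \<zero>\<^bsub>V\<^esub>"
  using lact_l_distr[of "\<zero>\<^bsub>A\<^esub>" "\<zero>\<^bsub>A\<^esub>" x] lact_closed[of "\<zero>\<^bsub>A\<^esub>" x] by simp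

lemma lact_zero_right: "a \<in> carrier A \<Longrightarrow> a \<triangleright>\<^bsub>V\<^esub> \<zero>\<^bsub>V\<^esub> = \<zero>\<^bsub>V\<^esub>"
  using lact_r_distr[of a "\<zero>\<^bsub>V\<^esub>" "\<zero>\<^bsub>V\<^esub>"] lact_closed[of a "\<zero>\<^bsub>V\<^esub>"] by simp

lemma ract_zero_left: "b \<in> carrier B \<Longrightarrow> \<zero>\<^bsub>V\<^esub> \<triangleleft>\<^bsub>V\<^esub> b = \<zero>\<^bsub>V\<^esub>"
  using ract_l_distr[of "\<zero>\<^bsub>V\<^esub>" "\<zero>\<^bsub>V\<^esub>" b] ract_closed[of "\<zero>\<^bsub>V\<^esub>" b] by simp

lemma ract_zero_right: "x \<in> carrier V \<Longrightarrow> x \<triangleleft>\<^bsub>V\<^esub> \<zero>\<^bsub>B\<^esub> = \<zero>\<^bsub>V\<^esub>"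
  using ract_r_distr[of x "\<zero>\<^bsub>B\<^esub>" "\<zero>\<^bsub>B\<^esub>"] ract_closed[of x "\<zero>\<^bsub>B\<^esub>"] by simp

end

section \<open>Ring structure on the matrices of a Morita context\<close>

context morita_context
begin

sublocale P: tensor_hom A B M N \<phi>
  by unfold_locales (rule phi_hom)

sublocale Q: tensor_hom B A N M \<psi>
  by unfold_locales (rule psi_hom)

abbreviation R where "R \<equiv> morita_ring A B M N \<phi> \<psi>"

lemma R_carrier: "carrier R = carrier A \<times> carrier M \<times> carrier N \<times> carrier B"
  by (simp add: morita_ring_def)

lemma R_mult: "(a, m, n, b) \<otimes>\<^bsub>R\<^esub> (a', m', n', b') =
    (a \<otimes>\<^bsub>A\<^esub> a' \<oplus>\<^bsub>A\<^esub> P.pairing m n', (a \<triangleright>\<^bsub>M\<^esub> m') \<oplus>\<^bsub>M\<^esub> (m \<triangleleft>\<^bsub>M\<^esub> b'),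
     (n \<triangleleft>\<^bsub>N\<^esub> a') \<oplus>\<^bsub>N\<^esub> (b \<triangleright>\<^bsub>N\<^esub> n'), Q.pairing n m' \<oplus>\<^bsub>B\<^esub> b \<otimes>\<^bsub>B\<^esub> b')"
  by (simp add: morita_ring_def P.pairing_def Q.pairing_def)

lemma R_add: "(a, m, n, b) \<oplus>\<^bsub>R\<^esub> (a', m', n', b') =
    (a \<oplus>\<^bsub>A\<^esub> a', m \<oplus>\<^bsub>M\<^esub> m', n \<oplus>\<^bsub>N\<^esub> n', b \<oplus>\<^bsub>B\<^esub> b')"
  by (simp add: morita_ring_def)

lemma R_one: "\<one>\<^bsub>R\<^esub> = (\<one>\<^bsub>A\<^esub>, \<zero>\<^bsub>M\<^esub>, \<zero>\<^bsub>N\<^esub>, \<one>\<^bsub>B\<^esub>)"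
  by (simp add: morita_ring_def)

lemma R_zero: "\<zero>\<^bsub>R\<^esub> = (\<zero>\<^bsub>A\<^esub>, \<zero>\<^bsub>M\<^esub>, \<zero>\<^bsub>N\<^esub>, \<zero>\<^bsub>B\<^esub>)"
  by (simp add: morita_ring_def)

lemmas R_ops = R_carrier R_mult R_add R_one R_zero

lemma ract_pairing:
  "\<lbrakk>n \<in> carrier N; m \<in> carrier M; n' \<in> carrier N\<rbrakk> \<Longrightarrow>
    n \<triangleleft>\<^bsub>N\<^esub> P.pairing m n' = Q.pairing n m \<triangleright>\<^bsub>N\<^esub> n'"
  "\<lbrakk>m \<in> carrier M; n \<in> carrier N; m' \<in> carrier M\<rbrakk> \<Longrightarrow>
    m \<triangleleft>\<^bsub>M\<^esub> Q.pairing n m' = P.pairing m n \<triangleright>\<^bsub>M\<^esub> m'"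
  unfolding P.pairing_def Q.pairing_def by (rule compat_N compat_M; assumption)+

lemmas action_closed = M.lact_closed M.ract_closed N.lact_closed N.ract_closed
  P.pairing_closed Q.pairing_closed

lemmas action_distr = M.lact_l_distr M.lact_r_distr M.ract_l_distr M.ract_r_distr
  N.lact_l_distr N.lact_r_distr N.ract_l_distr N.ract_r_distr
  P.pairing_add_left P.pairing_add_right Q.pairing_add_left Q.pairing_add_right

lemmas action_assoc = M.lact_assoc M.ract_assoc N.lact_assoc N.ract_assoc M.lact_ract N.lact_ract
  P.pairing_lact P.pairing_ract Q.pairing_lact Q.pairing_ract
  P.pairing_balanced Q.pairing_balanced ract_pairing

lemmas action_zero = M.lact_zero_left M.lact_zero_right M.ract_zero_left M.ract_zero_right
  N.lact_zero_left N.lact_zero_right N.ract_zero_left N.ract_zero_right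
  P.pairing_zero_left P.pairing_zero_right Q.pairing_zero_left Q.pairing_zero_right

text \<open>The diagonal entries agree by linearity and balancedness of the two pairings. The
  off-diagonal entries are where the compatibility laws \<open>(mn)m' = m(nm')\<close> and
  \<open>(nm)n' = n(mn')\<close> enter.\<close>

lemma R_m_assoc:
  assumes "a \<in> carrier A" "m \<in> carrier M" "n \<in> carrier N" "b \<in> carrier B"
    "a' \<in> carrier A" "m' \<in> carrier M" "n' \<in> carrier N" "b' \<in> carrier B"
    "a'' \<in> carrier A" "m'' \<in> carrier M" "n'' \<in> carrier N" "b'' \<in> carrier B"
  shows "((a, m, n, b) \<otimes>\<^bsub>R\<^esub> (a', m', n', b')) \<otimes>\<^bsub>R\<^esub> (a'', m'', n'', b'')
    = (a, m, n, b) \<otimes>\<^bsub>R\<^esub> ((a', m', n', b') \<otimes>\<^bsub>R\<^esub> (a'', m'', n'', b''))"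
  unfolding R_mult prod.inject
  using assms
  by (intro conjI; simp add: action_closed action_distr action_assoc A.l_distr A.r_distr
      B.l_distr B.r_distr A.m_assoc B.m_assoc A.a_ac B.a_ac M.V.a_ac N.V.a_ac)

lemma R_abelian_group: "abelian_group R"
proof (rule abelian_groupI)
  fix x assume "x \<in> carrier R"
  then obtain a m n b where x: "x = (a, m, n, b)"
    and c: "a \<in> carrier A" "m \<in> carrier M" "n \<in> carrier N" "b \<in> carrier B"
    by (auto simp: R_carrier)
  show "\<exists>y \<in> carrier R. y \<oplus>\<^bsub>R\<^esub> x = \<zero>\<^bsub>R\<^esub>"
    using c unfolding x
    by (intro bexI[of _ "(\<ominus>\<^bsub>A\<^esub> a, \<ominus>\<^bsub>M\<^esub> m, \<ominus>\<^bsub>N\<^esub> n, \<ominus>\<^bsub>B\<^esub> b)"])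
      (simp_all add: R_ops A.l_neg B.l_neg M.V.l_neg N.V.l_neg)
qed (auto simp: R_ops A.a_ac B.a_ac M.V.a_ac N.V.a_ac)

lemma R_monoid: "monoid R"
proof (rule monoidI)
  fix x y z assume "x \<in> carrier R" "y \<in> carrier R" "z \<in> carrier R"
  then show "x \<otimes>\<^bsub>R\<^esub> y \<otimes>\<^bsub>R\<^esub> z = x \<otimes>\<^bsub>R\<^esub> (y \<otimes>\<^bsub>R\<^esub> z)"
    by (cases x; cases y; cases z) (simp only: R_carrier mem_Sigma_iff R_m_assoc)
qed (auto simp: R_ops action_closed action_zero M.lact_one M.ract_one N.lact_one N.ract_one)

lemma R_ring: "ring R"
proof (rule ringI[OF R_abelian_group R_monoid])
  fix x y z assume "x \<in> carrier R" "y \<in> carrier R" "z \<in> carrier R"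
  then show "(x \<oplus>\<^bsub>R\<^esub> y) \<otimes>\<^bsub>R\<^esub> z = x \<otimes>\<^bsub>R\<^esub> z \<oplus>\<^bsub>R\<^esub> y \<otimes>\<^bsub>R\<^esub> z"
    "z \<otimes>\<^bsub>R\<^esub> (x \<oplus>\<^bsub>R\<^esub> y) = z \<otimes>\<^bsub>R\<^esub> x \<oplus>\<^bsub>R\<^esub> z \<otimes>\<^bsub>R\<^esub> y"
    by (cases x; cases y; cases z; simp add: R_ops action_closed action_distr A.l_distr A.r_distr
        B.l_distr B.r_distr A.a_ac B.a_ac M.V.a_ac N.V.a_ac)+
qed

end

section \<open>Nilness of the matrices with diagonal in the trace ideals\<close>

locale nilpotent_morita_context = morita_context A B M N \<phi> \<psi>
  for A :: "('a, 'x) ring_scheme" (structure) and B :: "('b, 'y) ring_scheme" (structure)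
    and M :: "('a, 'b, 'm, 'v) bimodule_scheme" (structure)
    and N :: "('b, 'a, 'n, 'w) bimodule_scheme" (structure)
    and \<phi> :: "('m \<times> 'n \<Rightarrow>\<^sub>0 int) set \<Rightarrow> 'a"
    and \<psi> :: "('n \<times> 'm \<Rightarrow>\<^sub>0 int) set \<Rightarrow> 'b" +
  assumes nil_A: "nilpotent_ideal A P.trace_ideal"
    and nil_B: "nilpotent_ideal B Q.trace_ideal"
begin

sublocale I: ideal P.trace_ideal A
  using nil_A by (simp add: nilpotent_ideal_def)

sublocale K: ideal Q.trace_ideal B
  using nil_B by (simp add: nilpotent_ideal_def)

sublocale R: ring R
  by (rule R_ring)

definition trace_pow :: "nat \<Rightarrow> 'a set"
  where "trace_pow k = P.trace_ideal [^]\<^bsub>ideals_set A\<^esub> k"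

sublocale I_pow: ideal "trace_pow k" A for k
  unfolding trace_pow_def by (rule A.ideal_pow_ideal) unfold_locales

lemma trace_pow_0: "trace_pow 0 = carrier A"
  by (simp add: trace_pow_def ideals_set_ops)

lemma trace_pow_mult: "\<lbrakk>x \<in> trace_pow k; y \<in> P.trace_ideal\<rbrakk> \<Longrightarrow> x \<otimes>\<^bsub>A\<^esub> y \<in> trace_pow (Suc k)"
  by (simp add: trace_pow_def ideals_set_ops ideal_prod.prod)

lemma trace_pow_Suc_subset: "trace_pow (Suc k) \<subseteq> trace_pow k"
  using A.ideal_prod_inter[OF I_pow.is_ideal I.is_ideal, of k]
  by (simp add: trace_pow_def ideals_set_ops)

definition trace_kernel where
  "trace_kernel = P.trace_ideal \<times> carrier M \<times> carrier N \<times> Q.trace_ideal"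

lemma trace_kernel_subset: "trace_kernel \<subseteq> carrier R"
  using I.Icarr K.Icarr by (auto simp: trace_kernel_def R_carrier simp del: image_iff)

lemma trace_kernel_mult_closed:
  assumes "x \<in> trace_kernel" "y \<in> trace_kernel"
  shows "x \<otimes>\<^bsub>R\<^esub> y \<in> trace_kernel"
  using assms
  by (auto simp: trace_kernel_def R_mult I.Icarr K.Icarr action_closed I.I_l_closed K.I_l_closed
      P.pairing_in_trace_ideal Q.pairing_in_trace_ideal I.a_closed K.a_closed simp del: image_iff)

text \<open>Depth \<open>k\<close> of a row \<open>(a, m)\<close>, with \<open>m\<close> tested only
  through its products with \<open>N\<close>: those lie in \<open>A\<close>, where powers of the
  trace ideal are available.\<close>

definition row :: "nat \<Rightarrow> 'a \<Rightarrow> 'm \<Rightarrow> bool"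
  where "row k a m \<longleftrightarrow> a \<in> trace_pow k \<and> m \<in> carrier M \<and> (\<forall>n \<in> carrier N. P.pairing m n \<in> trace_pow k)"

text \<open>For a generator \<open>b = n'm'\<close> one has \<open>(mb)n = (mn')(m'n)\<close>, whose
  first factor lies in the \<open>k\<close>-th power and whose second lies in the trace
  ideal.\<close>

lemma pairing_ract_trace:
  assumes m: "m \<in> carrier M" and n: "n \<in> carrier N" and b: "b \<in> Q.trace_ideal"
    and pow: "\<And>n. n \<in> carrier N \<Longrightarrow> P.pairing m n \<in> trace_pow k"
  shows "P.pairing (m \<triangleleft>\<^bsub>M\<^esub> b) n \<in> trace_pow (Suc k)"
  using b
proof (induction rule: Q.trace_ideal_induct)
  case (pairing n' m')
  then have "P.pairing (m \<triangleleft>\<^bsub>M\<^esub> Q.pairing n' m') n = P.pairing m n' \<otimes>\<^bsub>A\<^esub> P.pairing m' n"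
    using m n by (simp add: ract_pairing P.pairing_lact action_closed)
  then show ?case
    using trace_pow_mult[OF pow P.pairing_in_trace_ideal] pairing m n by simp
next
  case (add b c)
  then show ?case
    using m n by (simp add: M.ract_r_distr P.pairing_add_left action_closed I_pow.a_closed)
qed

text \<open>Right multiplication by the kernel improves \<open>m\<close> before \<open>a\<close>, so two factors are needed to gain a
  power of the trace ideal.\<close>

lemma row_step:
  assumes row: "row k a m" and x: "(a\<^sub>1, m\<^sub>1, n\<^sub>1, b\<^sub>1) \<in> trace_kernel"
  defines "a' \<equiv> a \<otimes>\<^bsub>A\<^esub> a\<^sub>1 \<oplus>\<^bsub>A\<^esub> P.pairing m n\<^sub>1"
    and "m' \<equiv> (a \<triangleright>\<^bsub>M\<^esub> m\<^sub>1) \<oplus>\<^bsub>M\<^esub> (m \<triangleleft>\<^bsub>M\<^esub> b\<^sub>1)"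
  shows "row (Suc k) (a' \<otimes>\<^bsub>A\<^esub> a\<^sub>1 \<oplus>\<^bsub>A\<^esub> P.pairing m' n\<^sub>1)
    ((a' \<triangleright>\<^bsub>M\<^esub> m\<^sub>1) \<oplus>\<^bsub>M\<^esub> (m' \<triangleleft>\<^bsub>M\<^esub> b\<^sub>1))"
proof -
  have a: "a \<in> trace_pow k" "a \<in> carrier A" and m: "m \<in> carrier M"
    and pow: "\<And>n. n \<in> carrier N \<Longrightarrow> P.pairing m n \<in> trace_pow k"
    using row I_pow.Icarr by (auto simp: row_def)
  have c: "a\<^sub>1 \<in> P.trace_ideal" "m\<^sub>1 \<in> carrier M" "n\<^sub>1 \<in> carrier N" "b\<^sub>1 \<in> Q.trace_ideal"
    using x by (simp_all add: trace_kernel_def del: image_iff)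
  have c': "a\<^sub>1 \<in> carrier A" "b\<^sub>1 \<in> carrier B"
    using c I.Icarr K.Icarr by blast+
  have a': "a' \<in> trace_pow k"
    unfolding a'_def using a c c' pow by (intro I_pow.a_closed I_pow.I_r_closed) auto
  then have a'c: "a' \<in> carrier A"
    by (rule I_pow.Icarr)
  have m': "m' \<in> carrier M"
    unfolding m'_def using a c c' m by (simp add: action_closed)
  \<comment> \<open>Stated for arbitrary \<open>d\<close> and \<open>u\<close> because it serves
    twice: for \<open>(a, m)\<close>, producing \<open>m'\<close>, and for \<open>(a', m')\<close>,
    producing the final entry in \<open>M\<close>.\<close>
  have step: "P.pairing ((d \<triangleright>\<^bsub>M\<^esub> m\<^sub>1) \<oplus>\<^bsub>M\<^esub> (u \<triangleleft>\<^bsub>M\<^esub> b\<^sub>1)) n \<in> trace_pow (Suc k)"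
    if "d \<in> trace_pow k" "u \<in> carrier M" "\<And>n. n \<in> carrier N \<Longrightarrow> P.pairing u n \<in> trace_pow k"
      and n: "n \<in> carrier N" for d u n
  proof -
    have d: "d \<in> carrier A"
      using that(1) by (rule I_pow.Icarr)
    have "d \<otimes>\<^bsub>A\<^esub> P.pairing m\<^sub>1 n \<in> trace_pow (Suc k)"
      using trace_pow_mult[OF that(1) P.pairing_in_trace_ideal] c n by simp
    moreover have "P.pairing (u \<triangleleft>\<^bsub>M\<^esub> b\<^sub>1) n \<in> trace_pow (Suc k)"
      using pairing_ract_trace[OF that(2) n c(4) that(3)] .
    ultimately show ?thesis
      using d that(2) n c c' by (simp add: P.pairing_add_left P.pairing_lact action_closed I_pow.a_closed)
  qed
  have m'_pow: "P.pairing m' n \<in> trace_pow (Suc k)" if "n \<in> carrier N" for n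
    unfolding m'_def using step[OF a(1) m pow that] .
  \<comment> \<open>The entry \<open>a'\<close> is still only of depth \<open>k\<close>, since its
    summand \<open>m n\<^sub>1\<close> has gained nothing yet. For the second use of
    \<open>step\<close>, \<open>m'\<close> is therefore weakened to the same depth.\<close>
  then have "P.pairing m' n \<in> trace_pow k" if "n \<in> carrier N" for n
    using that trace_pow_Suc_subset by blast
  then have "P.pairing ((a' \<triangleright>\<^bsub>M\<^esub> m\<^sub>1) \<oplus>\<^bsub>M\<^esub> (m' \<triangleleft>\<^bsub>M\<^esub> b\<^sub>1)) n \<in> trace_pow (Suc k)"
    if "n \<in> carrier N" for n
    using step[OF a' m' _ that] by blast
  moreover have "a' \<otimes>\<^bsub>A\<^esub> a\<^sub>1 \<oplus>\<^bsub>A\<^esub> P.pairing m' n\<^sub>1 \<in> trace_pow (Suc k)"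
    using trace_pow_mult[OF a' c(1)] m'_pow[OF c(3)] by (rule I_pow.a_closed)
  ultimately show ?thesis
    using a'c m' c c' by (simp add: row_def action_closed)
qed

text \<open>The second row \<open>(n, b)\<close> has no entry in \<open>A\<close>. Multiplying it
  from the left by each \<open>m'\<close> gives \<open>(m'n, m'b)\<close>, a row of the first type,
  so one step lemma covers both rows.\<close>

definition rows :: "nat \<Rightarrow> 'a \<times> 'm \<times> 'n \<times> 'b \<Rightarrow> bool"
  where "rows k = (\<lambda>(a, m, n, b). row k a m \<and>
    (\<forall>m' \<in> carrier M. row k (P.pairing m' n) (m' \<triangleleft>\<^bsub>M\<^esub> b)))"

lemma rows_step:
  assumes y: "y \<in> carrier R" and rows: "rows k y" and x: "x \<in> trace_kernel"
  shows "rows (Suc k) (y \<otimes>\<^bsub>R\<^esub> x \<otimes>\<^bsub>R\<^esub> x)"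
proof -
  obtain a m n b where y_eq: "y = (a, m, n, b)"
    and yc: "a \<in> carrier A" "m \<in> carrier M" "n \<in> carrier N" "b \<in> carrier B"
    using y by (auto simp: R_carrier)
  obtain a\<^sub>1 m\<^sub>1 n\<^sub>1 b\<^sub>1 where x_eq: "x = (a\<^sub>1, m\<^sub>1, n\<^sub>1, b\<^sub>1)"
    by (cases x)
  have xc: "a\<^sub>1 \<in> carrier A" "m\<^sub>1 \<in> carrier M" "n\<^sub>1 \<in> carrier N" "b\<^sub>1 \<in> carrier B"
    using subsetD[OF trace_kernel_subset x] by (simp_all add: x_eq R_carrier)
  \<comment> \<open>Multiplying a second row from the left by \<open>u\<close> commutes with
    multiplying it from the right by \<open>x\<close>: this is associativity, read off entry by
    entry.\<close>
  have move: "P.pairing u ((n' \<triangleleft>\<^bsub>N\<^esub> a\<^sub>1) \<oplus>\<^bsub>N\<^esub> (b' \<triangleright>\<^bsub>N\<^esub> n\<^sub>1))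
      = P.pairing u n' \<otimes>\<^bsub>A\<^esub> a\<^sub>1 \<oplus>\<^bsub>A\<^esub> P.pairing (u \<triangleleft>\<^bsub>M\<^esub> b') n\<^sub>1"
    "u \<triangleleft>\<^bsub>M\<^esub> (Q.pairing n' m\<^sub>1 \<oplus>\<^bsub>B\<^esub> b' \<otimes>\<^bsub>B\<^esub> b\<^sub>1)
      = (P.pairing u n' \<triangleright>\<^bsub>M\<^esub> m\<^sub>1) \<oplus>\<^bsub>M\<^esub> (u \<triangleleft>\<^bsub>M\<^esub> b' \<triangleleft>\<^bsub>M\<^esub> b\<^sub>1)"
    if "u \<in> carrier M" "n' \<in> carrier N" "b' \<in> carrier B" for u n' b'
    using that xc by (simp_all add: action_closed action_distr action_assoc)
  have "row (Suc k) (fst (y \<otimes>\<^bsub>R\<^esub> x \<otimes>\<^bsub>R\<^esub> x)) (fst (snd (y \<otimes>\<^bsub>R\<^esub> x \<otimes>\<^bsub>R\<^esub> x)))"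
    using row_step[of k a m a\<^sub>1 m\<^sub>1 n\<^sub>1 b\<^sub>1] rows x
    by (simp add: y_eq x_eq rows_def R_mult)
  moreover have "row (Suc k) (P.pairing u (fst (snd (snd (y \<otimes>\<^bsub>R\<^esub> x \<otimes>\<^bsub>R\<^esub> x)))))
      (u \<triangleleft>\<^bsub>M\<^esub> snd (snd (snd (y \<otimes>\<^bsub>R\<^esub> x \<otimes>\<^bsub>R\<^esub> x))))" if "u \<in> carrier M" for u
    using row_step[of k "P.pairing u n" "u \<triangleleft>\<^bsub>M\<^esub> b" a\<^sub>1 m\<^sub>1 n\<^sub>1 b\<^sub>1] rows x that yc xc
    by (simp add: y_eq x_eq rows_def R_mult move action_closed)
  ultimately show ?thesis
    by (simp add: rows_def case_prod_beta)
qed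

text \<open>The induction starts at the identity matrix, which has depth 0 because the zeroth power
  of the trace ideal is all of \<open>A\<close>; each gain in depth costs two factors
  \<open>x\<close>.\<close>

lemma rows_pow:
  assumes x: "x \<in> trace_kernel"
  shows "rows k (x [^]\<^bsub>R\<^esub> (2 * k))"
proof (induction k)
  case 0
  show ?case
    by (auto simp: rows_def row_def R_one trace_pow_0 action_closed)
next
  case (Suc k)
  have "x \<in> carrier R"
    using x trace_kernel_subset by blast
  then show ?case
    using rows_step[OF _ Suc x] by simp
qed

lemma trace_kernel_pow:
  assumes "x \<in> trace_kernel" "k > 0"
  shows "x [^]\<^bsub>R\<^esub> (k::nat) \<in> trace_kernel"
  using assms(2,1)
proof (induction k rule: nat_induct_non_zero)
  case 1
  then show ?case
    using subsetD[OF trace_kernel_subset] by simp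
next
  case (Suc k)
  then show ?case
    by (simp add: trace_kernel_mult_closed)
qed

text \<open>If the \<open>k\<close>-th power of \<open>MN\<close> is zero, then
  \<open>x^(2k)\<close> has the form \<open>(0, m, n, b)\<close> with \<open>mN = 0\<close> and
  \<open>Mn = 0\<close>. As \<open>b\<close> is a sum of products \<open>n'm'\<close>, the
  identities \<open>m(n'm') = (mn')m'\<close> and \<open>(n'm')n = n'(m'n)\<close> give
  \<open>mb = 0\<close> and \<open>bn = 0\<close>. So the square of this matrix is
  \<open>(0, 0, 0, d)\<close> with \<open>d = nm + b^2\<close> in the nilpotent ideal
  \<open>NM\<close>.\<close>

lemma trace_kernel_nil:
  assumes x: "x \<in> trace_kernel"
  shows "nilpotent_elem R x"
proof -
  have xc: "x \<in> carrier R"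
    using x trace_kernel_subset by blast
  obtain k :: nat where k: "k > 0" "trace_pow k = {\<zero>\<^bsub>A\<^esub>}"
    using nil_A by (auto simp: nilpotent_ideal_def trace_pow_def)
  obtain a m n b where y: "x [^]\<^bsub>R\<^esub> (2 * k) = (a, m, n, b)"
    by (cases "x [^]\<^bsub>R\<^esub> (2 * k)")
  have yK: "(a, m, n, b) \<in> trace_kernel"
    using trace_kernel_pow[OF x, of "2 * k"] k y by simp
  then have c: "m \<in> carrier M" "n \<in> carrier N" "b \<in> Q.trace_ideal"
    by (simp_all add: trace_kernel_def del: image_iff)
  have bc: "b \<in> carrier B"
    using c(3) by (rule K.Icarr)
  have a0: "a = \<zero>\<^bsub>A\<^esub>" and m0: "\<And>n'. n' \<in> carrier N \<Longrightarrow> P.pairing m n' = \<zero>\<^bsub>A\<^esub>"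
    and n0: "\<And>m'. m' \<in> carrier M \<Longrightarrow> P.pairing m' n = \<zero>\<^bsub>A\<^esub>"
    using rows_pow[OF x, of k] k by (auto simp: rows_def row_def y)
  have mb: "m \<triangleleft>\<^bsub>M\<^esub> b = \<zero>\<^bsub>M\<^esub>"
    using c(3)
  proof (induction rule: Q.trace_ideal_induct)
    case (pairing n' m')
    then show ?case
      using m0 c by (simp add: ract_pairing action_zero)
  next
    case (add b c)
    then show ?case
      using \<open>m \<in> carrier M\<close> by (simp add: M.ract_r_distr)
  qed
  have bn: "b \<triangleright>\<^bsub>N\<^esub> n = \<zero>\<^bsub>N\<^esub>"
    using c(3)
  proof (induction rule: Q.trace_ideal_induct)
    case (pairing n' m')
    then show ?case
      using n0 c by (simp add: ract_pairing[symmetric] action_zero)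
  next
    case (add b c)
    then show ?case
      using \<open>n \<in> carrier N\<close> by (simp add: N.lact_l_distr)
  qed
  define d where "d = Q.pairing n m \<oplus>\<^bsub>B\<^esub> b \<otimes>\<^bsub>B\<^esub> b"
  have "d \<in> Q.trace_ideal"
    unfolding d_def using c bc by (intro K.a_closed K.I_l_closed Q.pairing_in_trace_ideal)
  then obtain l :: nat where dc: "d \<in> carrier B" and l: "l > 0" "d [^]\<^bsub>B\<^esub> l = \<zero>\<^bsub>B\<^esub>"
    using B.nilpotent_ideal_elem[OF nil_B] by (auto simp: nilpotent_elem_def)
  have "(a, m, n, b) \<otimes>\<^bsub>R\<^esub> (a, m, n, b) = (\<zero>\<^bsub>A\<^esub>, \<zero>\<^bsub>M\<^esub>, \<zero>\<^bsub>N\<^esub>, d)"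
    using c bc by (simp add: R_mult a0 m0 mb bn action_zero d_def)
  then have y2: "x [^]\<^bsub>R\<^esub> (2 * k + 2 * k) = (\<zero>\<^bsub>A\<^esub>, \<zero>\<^bsub>M\<^esub>, \<zero>\<^bsub>N\<^esub>, d)"
    using R.nat_pow_mult[OF xc, of "2 * k" "2 * k"] y by simp
  \<comment> \<open>The exponent 0 is excluded because it gives the identity matrix, with 1 instead
    of 0 in the corner \<open>A\<close>.\<close>
  have "(\<zero>\<^bsub>A\<^esub>, \<zero>\<^bsub>M\<^esub>, \<zero>\<^bsub>N\<^esub>, d) [^]\<^bsub>R\<^esub> j = (\<zero>\<^bsub>A\<^esub>, \<zero>\<^bsub>M\<^esub>, \<zero>\<^bsub>N\<^esub>, d [^]\<^bsub>B\<^esub> j)" if "j > 0" for j :: nat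
    using that
  proof (induction j rule: nat_induct_non_zero)
    case 1
    then show ?case
      using dc R.nat_pow_Suc[of "(\<zero>\<^bsub>A\<^esub>, \<zero>\<^bsub>M\<^esub>, \<zero>\<^bsub>N\<^esub>, d)" 0] by (simp add: R_carrier)
  next
    case (Suc j)
    then show ?case
      using dc by (simp add: R_mult action_zero)
  qed
  then have "nilpotent_elem R (\<zero>\<^bsub>A\<^esub>, \<zero>\<^bsub>M\<^esub>, \<zero>\<^bsub>N\<^esub>, d)"
    using l dc by (intro R.nilpotent_elemI[of _ l]) (simp_all add: R_carrier R_zero)
  then show ?thesis
    using R.nilpotent_elem_pow[OF xc, of "2 * k + 2 * k"] y2 by simp
qed

text \<open>The diagonal is multiplicative modulo the trace ideals, since the cross terms
  \<open>mn'\<close> and \<open>nm'\<close> in the diagonal entries of a product lie in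
  them.\<close>

lemma diagonal_hom:
  "nil_kernel_hom R (RDirProd (A Quot P.trace_ideal) (B Quot Q.trace_ideal))
    (\<lambda>(a, m, n, b). (P.trace_ideal +>\<^bsub>A\<^esub> a, Q.trace_ideal +>\<^bsub>B\<^esub> b))"
  (is "nil_kernel_hom R ?S ?h")
proof -
  interpret f: ring_hom_ring A "A Quot P.trace_ideal" "(+>\<^bsub>A\<^esub>) P.trace_ideal"
    by (rule I.rcos_ring_hom_ring)
  interpret g: ring_hom_ring B "B Quot Q.trace_ideal" "(+>\<^bsub>B\<^esub>) Q.trace_ideal"
    by (rule K.rcos_ring_hom_ring)
  have S: "ring ?S"
    by (intro RDirProd_ring f.S.ring_axioms g.S.ring_axioms)
  have p0: "P.trace_ideal +>\<^bsub>A\<^esub> P.pairing m n = \<zero>\<^bsub>A Quot P.trace_ideal\<^esub>"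
    and q0: "Q.trace_ideal +>\<^bsub>B\<^esub> Q.pairing n m = \<zero>\<^bsub>B Quot Q.trace_ideal\<^esub>"
    if "m \<in> carrier M" "n \<in> carrier N" for m n
    by (simp_all only: I.rcos_zero_iff K.rcos_zero_iff P.pairing_in_trace_ideal
        Q.pairing_in_trace_ideal action_closed that)
  have h: "?h \<in> ring_hom R ?S"
  proof (rule ring_hom_memI)
    fix x y assume "x \<in> carrier R" "y \<in> carrier R"
    then show "?h (x \<otimes>\<^bsub>R\<^esub> y) = ?h x \<otimes>\<^bsub>?S\<^esub> ?h y" "?h (x \<oplus>\<^bsub>R\<^esub> y) = ?h x \<oplus>\<^bsub>?S\<^esub> ?h y"
      by (auto simp: R_ops RDirProd_ops action_closed p0 q0)
  qed (auto simp: R_ops RDirProd_carrier RDirProd_ops)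
  have "?h ` carrier R = carrier ?S"
  proof (intro equalityI subsetI)
    fix z assume "z \<in> carrier ?S"
    then obtain a b where z: "z = (P.trace_ideal +>\<^bsub>A\<^esub> a, Q.trace_ideal +>\<^bsub>B\<^esub> b)"
      and "a \<in> carrier A" "b \<in> carrier B"
      by (auto simp: RDirProd_carrier I.rcos_surj[symmetric] K.rcos_surj[symmetric])
    then have "(a, \<zero>\<^bsub>M\<^esub>, \<zero>\<^bsub>N\<^esub>, b) \<in> carrier R" "z = ?h (a, \<zero>\<^bsub>M\<^esub>, \<zero>\<^bsub>N\<^esub>, b)"
      by (simp_all add: R_carrier)
    then show "z \<in> ?h ` carrier R"
      by (rule rev_image_eqI)
  qed (auto simp: R_carrier RDirProd_carrier)
  moreover have "nilpotent_elem R x" if "x \<in> carrier R" "?h x = \<zero>\<^bsub>?S\<^esub>" for x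
  proof -
    have "x \<in> trace_kernel"
      using that I.rcos_zero_iff K.rcos_zero_iff
      by (auto simp: trace_kernel_def R_carrier RDirProd_ops simp del: image_iff)
    then show ?thesis
      by (rule trace_kernel_nil)
  qed
  ultimately show ?thesis
    using ring_hom_ringI2[OF R.ring_axioms S h]
    by (simp add: nil_kernel_hom_def nil_kernel_hom_axioms_def)
qed

lemma unit_nil_clean_iff: "unit_nil_clean R \<longleftrightarrow> unit_nil_clean A \<and> unit_nil_clean B"
  using nil_kernel_hom.unit_nil_clean_iff[OF diagonal_hom]
    nil_kernel_hom.unit_nil_clean_iff[OF A.nilpotent_ideal_quotient[OF nil_A]]
    nil_kernel_hom.unit_nil_clean_iff[OF B.nilpotent_ideal_quotient[OF nil_B]]
    RDirProd_unit_nil_clean[OF I.quotient_is_ring K.quotient_is_ring]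
  by simp

lemma strongly_unit_nil_clean_iff:
  "strongly_unit_nil_clean R \<longleftrightarrow> strongly_unit_nil_clean A \<and> strongly_unit_nil_clean B"
  using nil_kernel_hom.strongly_unit_nil_clean_iff[OF diagonal_hom]
    nil_kernel_hom.strongly_unit_nil_clean_iff[OF A.nilpotent_ideal_quotient[OF nil_A]]
    nil_kernel_hom.strongly_unit_nil_clean_iff[OF B.nilpotent_ideal_quotient[OF nil_B]]
    RDirProd_strongly_unit_nil_clean[OF I.quotient_is_ring K.quotient_is_ring]
  by simp

end

theorem theorem3p11:
  fixes A :: "('a, 'x) ring_scheme" and B :: "('b, 'y) ring_scheme"
    and M :: "('a, 'b, 'm, 'v) bimodule_scheme" and N :: "('b, 'a, 'n, 'w) bimodule_scheme"
    and \<phi> :: "('m \<times> 'n \<Rightarrow>\<^sub>0 int) set \<Rightarrow> 'a" and \<psi> :: "('n \<times> 'm \<Rightarrow>\<^sub>0 int) set \<Rightarrow> 'b"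
  assumes "morita_context A B M N \<phi> \<psi>"
    and "nilpotent_ideal A (\<phi> ` carrier (tensor_product B M N))"
    and "nilpotent_ideal B (\<psi> ` carrier (tensor_product A N M))"
  shows "(unit_nil_clean (morita_ring A B M N \<phi> \<psi>) \<longleftrightarrow>
            unit_nil_clean A \<and> unit_nil_clean B) \<and>
         (strongly_unit_nil_clean (morita_ring A B M N \<phi> \<psi>) \<longleftrightarrow>
            strongly_unit_nil_clean A \<and> strongly_unit_nil_clean B)"
proof -
  interpret nilpotent_morita_context A B M N \<phi> \<psi>
    using assms by (simp add: nilpotent_morita_context_def nilpotent_morita_context_axioms_def)
  show ?thesis
    using unit_nil_clean_iff strongly_unit_nil_clean_iff by blast
qed

end
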